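(* Let $n \ge 2$. (1) The standard monomials of even length, that is, $R_{1,a_1}R_{2,a_2}\cdots R_{n-1,a_{n-1}}$ with $0 \le a_i\le i$ $(1 \le i \le n-1)$ such that $a_1 +\cdots +a_{n-1}$ is even, form a basis for the algebra $\mathcal{H}^-_{n,\bar 0}$. In particular, $\dim \mathcal{H}^-_{n,\bar 0} =\frac12 n!$. (2) The elements $\tilde T_{1,a_1}\tilde T_{2,a_2}\cdots \tilde T_{n-1,a_{n-1}}$ and $z\tilde T_{1,a_1}\tilde T_{2,a_2}\cdots \tilde T_{n-1,a_{n-1}}$ with $0 \le a_i\le i$ $(1 \le i \le n-1)$ such that $a_1 +\cdots +a_{n-1}$ is even, form a basis for the algebra $\mathcal{H}^{\sim}_{n,\bar 0}$. In particular, $\dim \mathcal{H}^{\sim}_{n,\bar 0} =n!$.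
   Context: Let $q$ be a formal parameter and $\varepsilon=q-q^{-1}$. All algebras are unital associative $\mathbb{C}(q)$-algebras, and bases and dimensions are over $\mathbb{C}(q)$. The spin Hecke algebra $\mathcal{H}_n^-$ is generated by $R_i$ $(1\le i\le n-1)$ subject to: $R_i^2=-\varepsilon^2-2$; $R_iR_j=-R_jR_i$ for $|i-j|>1$; $R_iR_{i+1}R_i-R_{i+1}R_iR_{i+1}=\varepsilon^2(R_{i+1}-R_i)$. It is a superalgebra ($\mathbb{Z}_2$-graded algebra) with every $R_i$ odd. The covering Hecke algebra $\mathcal{H}_n^{\sim}$ is generated by $z$ and $\tilde T_i$ $(1\le i\le n-1)$ subject to: $z^2=1$ and $z$ is central; $\tilde T_i^2=z(q^2+q^{-2}+1)+1$; $\tilde T_i\tilde T_j=z\tilde T_j\tilde T_i$ for $|i-j|>1$; $\tilde T_i\tilde T_{i+1}\tilde T_i-\tilde T_{i+1}\tilde T_i\tilde T_{i+1}=\varepsilon^2(\tilde T_{i+1}-\tilde T_i)$. It is a superalgebra with $z$ even and every $\tilde T_i$ odd. $\mathcal{H}^-_{n,\bar 0}$ and $\mathcal{H}^{\sim}_{n,\bar 0}$ denote the even subalgebras of $\mathcal{H}_n^-$ and $\mathcal{H}_n^{\sim}$ respectively. For $1\le i\le n-1$ and $0\le a\le i$ put $R_{i,a}:=R_iR_{i-1}\cdots R_{i-a+1}$ and $\tilde T_{i,a}:=\tilde T_i\tilde T_{i-1}\cdots\tilde T_{i-a+1}$ (products of $a$ generators), with $R_{i,0}=1$ and $\tilde T_{i,0}=1$.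 *)

theory Defs
  imports
    "Jordan_Normal_Form.VS_Connect"
    "HOL-Library.Poly_Mapping"
    "HOL-Library.FuncSet"
    "HOL-Computational_Algebra.Fraction_Field"
    "HOL-Algebra.QuotRing"
begin

text \<open>Words in the letters \<open>'x\<close>, written additively so that finitely supported functions on them
  form a ring under convolution: the free associative algebra.\<close>

datatype 'x gword = GWord (letters: "'x list")

instantiation gword :: (type) monoid_add
begin

definition zero_gword :: "'a gword" where
  "0 = GWord []"

definition plus_gword :: "'a gword \<Rightarrow> 'a gword \<Rightarrow> 'a gword" where
  "u + v = GWord (letters u @ letters v)"

instance
  by standard (simp_all add: zero_gword_def plus_gword_def)

end

type_synonym ('k, 'x) ncpoly = "'x gword \<Rightarrow>\<^sub>0 'k"

definition scal :: "'k::field \<Rightarrow> ('k, 'x) ncpoly" where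
  "scal c = Poly_Mapping.single 0 c"

definition gen :: "'x \<Rightarrow> ('k::field, 'x) ncpoly" where
  "gen x = Poly_Mapping.single (GWord [x]) 1"

definition free_alg :: "'x set \<Rightarrow> ('k::field, ('k, 'x) ncpoly) module" where
  "free_alg X = \<lparr>carrier = {p. \<forall>w\<in>Poly_Mapping.keys p. set (letters w) \<subseteq> X},
     mult = (*), one = 1, zero = 0, add = (+), smult = (\<lambda>c p. scal c * p)\<rparr>"

definition quot_alg :: "('k, 'a) module \<Rightarrow> 'a set \<Rightarrow> ('k, 'a set) module" where
  "quot_alg A I = \<lparr>carrier = carrier (A Quot I), mult = mult (A Quot I), one = one (A Quot I),
     zero = zero (A Quot I), add = add (A Quot I),
     smult = (\<lambda>c C. \<Union>a\<in>C. I +>\<^bsub>A\<^esub> (c \<odot>\<^bsub>A\<^esub> a))\<rparr>"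

text \<open>A relation \<open>l = r\<close> is the pair \<open>(l, r)\<close>. HOL-Algebra ideals are two-sided.\<close>

definition rel_ideal ::
  "'x set \<Rightarrow> (('k::field, 'x) ncpoly \<times> ('k, 'x) ncpoly) set \<Rightarrow> ('k, 'x) ncpoly set" where
  "rel_ideal X S = Idl\<^bsub>free_alg X\<^esub> {l - r | l r. (l, r) \<in> S}"

definition presented_alg ::
  "'x set \<Rightarrow> (('k::field, 'x) ncpoly \<times> ('k, 'x) ncpoly) set \<Rightarrow> ('k, ('k, 'x) ncpoly set) module" where
  "presented_alg X S = quot_alg (free_alg X) (rel_ideal X S)"

definition cls ::
  "'x set \<Rightarrow> (('k::field, 'x) ncpoly \<times> ('k, 'x) ncpoly) set \<Rightarrow> ('k, 'x) ncpoly \<Rightarrow> ('k, 'x) ncpoly set" where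
  "cls X S p = rel_ideal X S +>\<^bsub>free_alg X\<^esub> p"

text \<open>The generators satisfying \<open>odd_gen\<close> have degree 1 in \<open>\<int>/2\<close> and the others degree 0. When the
  relations are homogeneous, the grading of the free algebra descends to the quotient, whose even
  part is the image of the even part of the free algebra.\<close>

definition free_even :: "'x set \<Rightarrow> ('x \<Rightarrow> bool) \<Rightarrow> ('k::field, 'x) ncpoly set" where
  "free_even X odd_gen = {p \<in> carrier (free_alg X).
     \<forall>w\<in>Poly_Mapping.keys p. even (length (filter odd_gen (letters w)))}"

definition even_subalg ::
  "'x set \<Rightarrow> (('k::field, 'x) ncpoly \<times> ('k, 'x) ncpoly) set \<Rightarrow> ('x \<Rightarrow> bool)
    \<Rightarrow> ('k, ('k, 'x) ncpoly set) module" where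
  "even_subalg X S odd_gen = (presented_alg X S)\<lparr>carrier := cls X S ` free_even X odd_gen\<rparr>"

lemma keys_scal: "Poly_Mapping.keys (scal c) \<subseteq> {0}"
  by (simp add: scal_def)

lemma scal_add: "scal (a + b) = scal a + scal b"
  by (simp add: scal_def single_add)

lemma scal_mult: "scal (a * b) = scal a * scal b"
  by (simp add: scal_def mult_single)

lemma scal_1: "scal 1 = 1"
  by (simp add: scal_def)

lemma scal_commute: "scal c * p = p * scal c" for p :: "('k::field, 'x) ncpoly"
proof (induction p rule: Poly_Mapping.update_induct)
  case const
  then show ?case by simp
next
  case (update f w d)
  have "Poly_Mapping.update w d f = f + Poly_Mapping.single w d"
    using update by (intro poly_mapping_eqI)
      (auto simp: lookup_update lookup_add lookup_single in_keys_iff when_def)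
  moreover have "scal c * Poly_Mapping.single w d = Poly_Mapping.single w d * scal c"
    by (simp add: scal_def mult_single mult.commute)
  ultimately show ?case
    using update by (simp add: distrib_left distrib_right)
qed

lemma free_alg_simps [simp]:
  "mult (free_alg X) = (*)" "one (free_alg X) = 1" "zero (free_alg X) = 0"
  "add (free_alg X) = (+)" "smult (free_alg X) c p = scal c * p"
  by (simp_all add: free_alg_def)

lemma free_alg_closed:
  "0 \<in> carrier (free_alg X)" "1 \<in> carrier (free_alg X)" "scal c \<in> carrier (free_alg X)"
  "p \<in> carrier (free_alg X) \<Longrightarrow> q \<in> carrier (free_alg X) \<Longrightarrow> p + q \<in> carrier (free_alg X)"
  "p \<in> carrier (free_alg X) \<Longrightarrow> - p \<in> carrier (free_alg X)"
  "p \<in> carrier (free_alg X) \<Longrightarrow> q \<in> carrier (free_alg X) \<Longrightarrow> p * q \<in> carrier (free_alg X)"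
proof -
  show "0 \<in> carrier (free_alg X)" by (simp add: free_alg_def)
  show "scal c \<in> carrier (free_alg X)"
    using keys_scal[of c] by (auto simp: free_alg_def zero_gword_def)
  show "1 \<in> carrier (free_alg X)" by (simp add: free_alg_def zero_gword_def)
  show "p \<in> carrier (free_alg X) \<Longrightarrow> q \<in> carrier (free_alg X) \<Longrightarrow> p + q \<in> carrier (free_alg X)"
    using Poly_Mapping.keys_add[of p q] by (auto simp: free_alg_def)
  show "p \<in> carrier (free_alg X) \<Longrightarrow> - p \<in> carrier (free_alg X)"
    by (auto simp: free_alg_def)
  show "p \<in> carrier (free_alg X) \<Longrightarrow> q \<in> carrier (free_alg X) \<Longrightarrow> p * q \<in> carrier (free_alg X)"
    using keys_mult[of p q] by (fastforce simp: free_alg_def plus_gword_def)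
qed

lemma free_alg_ring: "ring (free_alg X)"
proof (rule ringI)
  show "abelian_group (free_alg X)"
  proof (rule abelian_groupI)
    fix p assume "p \<in> carrier (free_alg X)"
    then show "\<exists>q\<in>carrier (free_alg X). q \<oplus>\<^bsub>free_alg X\<^esub> p = \<zero>\<^bsub>free_alg X\<^esub>"
      by (intro bexI[of _ "- p"]) (simp_all add: free_alg_closed)
  qed (simp_all add: free_alg_closed add.assoc add.commute)
  show "Group.monoid (free_alg X)"
    by (rule monoidI) (simp_all add: free_alg_closed mult.assoc)
qed (simp_all add: distrib_left distrib_right)

lemma rel_ideal_ideal:
  assumes "\<And>l r. (l, r) \<in> S \<Longrightarrow> l \<in> carrier (free_alg X) \<and> r \<in> carrier (free_alg X)"
  shows "ideal (rel_ideal X S) (free_alg X)"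
  unfolding rel_ideal_def
proof (rule ring.genideal_ideal[OF free_alg_ring])
  have "l - r \<in> carrier (free_alg X)" if "(l, r) \<in> S" for l r
    using assms[OF that] free_alg_closed(4)[of l X "- r"] free_alg_closed(5)[of r X] by simp
  then show "{l - r | l r. (l, r) \<in> S} \<subseteq> carrier (free_alg X)"
    by auto
qed

lemma quot_alg_simps:
  "carrier (quot_alg A I) = carrier (A Quot I)" "mult (quot_alg A I) = mult (A Quot I)"
  "one (quot_alg A I) = one (A Quot I)" "zero (quot_alg A I) = zero (A Quot I)"
  "add (quot_alg A I) = add (A Quot I)"
  by (simp_all add: quot_alg_def)

lemma quot_alg_ring:
  assumes "ideal I A"
  shows "ring (quot_alg A I)"
proof -
  interpret R: ring "A Quot I" using assms by (rule ideal.quotient_is_ring)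
  show ?thesis
  proof (rule ringI)
    show "abelian_group (quot_alg A I)"
      by (rule abelian_groupI)
        (simp_all add: quot_alg_simps R.add.m_ac R.add.l_inv_ex)
    show "Group.monoid (quot_alg A I)"
      by (rule monoidI) (auto simp: quot_alg_simps R.m_assoc)
  qed (auto simp: quot_alg_simps R.l_distr R.r_distr)
qed

lemma presented_alg_ops:
  assumes rels: "\<And>l r. (l, r) \<in> S \<Longrightarrow> l \<in> carrier (free_alg X) \<and> r \<in> carrier (free_alg X)"
    and p: "p \<in> carrier (free_alg X)"
  shows "cls X S p \<in> carrier (presented_alg X S)"
    "q \<in> carrier (free_alg X) \<Longrightarrow>
       cls X S p \<oplus>\<^bsub>presented_alg X S\<^esub> cls X S q = cls X S (p + q)"
    "q \<in> carrier (free_alg X) \<Longrightarrow>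
       cls X S p \<otimes>\<^bsub>presented_alg X S\<^esub> cls X S q = cls X S (p * q)"
    "c \<odot>\<^bsub>presented_alg X S\<^esub> cls X S p = cls X S (scal c * p)"
proof -
  interpret I: ideal "rel_ideal X S" "free_alg X" using rels by (rule rel_ideal_ideal)
  note hom = I.rcos_ring_hom
  show "cls X S p \<in> carrier (presented_alg X S)"
    using ring_hom_closed[OF hom p] by (simp add: presented_alg_def quot_alg_simps cls_def)
  show "cls X S p \<oplus>\<^bsub>presented_alg X S\<^esub> cls X S q = cls X S (p + q)" if q: "q \<in> carrier (free_alg X)"
    using ring_hom_add[OF hom p q] by (simp add: presented_alg_def quot_alg_simps cls_def)
  show "cls X S p \<otimes>\<^bsub>presented_alg X S\<^esub> cls X S q = cls X S (p * q)" if q: "q \<in> carrier (free_alg X)"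
    using ring_hom_mult[OF hom p q] by (simp add: presented_alg_def quot_alg_simps cls_def)
  have cls_eq: "cls X S (scal c * a) = cls X S (scal c * p)" if a: "a \<in> cls X S p" for a
  proof -
    obtain h where h: "h \<in> rel_ideal X S" and ah: "a = h + p"
      using a by (auto simp: cls_def a_r_coset_def')
    have "scal c * h \<in> rel_ideal X S"
      using I.I_l_closed[OF h free_alg_closed(3)[of c]] by simp
    moreover have "scal c * a = scal c * h + scal c * p"
      by (simp add: ah distrib_left)
    ultimately have "scal c * a \<in> cls X S (scal c * p)"
      by (auto simp: cls_def a_r_coset_def')
    then show ?thesis
      using I.a_repr_independence[OF _ _ I.a_subgroup, of "scal c * a" "scal c * p"]
      by (simp add: cls_def free_alg_closed p)
  qed
  have "p \<in> cls X S p"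
    using I.a_rcos_self[OF p] by (simp add: cls_def)
  with cls_eq have "(\<Union>a\<in>cls X S p. cls X S (scal c * a)) = cls X S (scal c * p)"
    by blast
  then show "c \<odot>\<^bsub>presented_alg X S\<^esub> cls X S p = cls X S (scal c * p)"
    by (simp add: presented_alg_def quot_alg_def cls_def)
qed

lemma presented_alg_carrier:
  "carrier (presented_alg X S) = cls X S ` carrier (free_alg X)"
  by (auto simp: presented_alg_def quot_alg_simps FactRing_def A_RCOSETS_def' RCOSETS_def
      a_r_coset_def cls_def)

lemma presented_alg_zero_one:
  assumes rels: "\<And>l r. (l, r) \<in> S \<Longrightarrow> l \<in> carrier (free_alg X) \<and> r \<in> carrier (free_alg X)"
  shows "\<zero>\<^bsub>presented_alg X S\<^esub> = cls X S 0" "\<one>\<^bsub>presented_alg X S\<^esub> = cls X S 1"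
proof -
  interpret I: ideal "rel_ideal X S" "free_alg X" using rels by (rule rel_ideal_ideal)
  show "\<zero>\<^bsub>presented_alg X S\<^esub> = cls X S 0"
    by (auto simp: presented_alg_def quot_alg_simps FactRing_def cls_def a_r_coset_def')
  show "\<one>\<^bsub>presented_alg X S\<^esub> = cls X S 1"
    by (simp add: presented_alg_def quot_alg_simps FactRing_def cls_def)
qed

lemma presented_alg_ring:
  assumes rels: "\<And>l r. (l, r) \<in> S \<Longrightarrow> l \<in> carrier (free_alg X) \<and> r \<in> carrier (free_alg X)"
  shows "ring (presented_alg X S)"
  unfolding presented_alg_def by (rule quot_alg_ring[OF rel_ideal_ideal[OF rels]])

lemma presented_alg_vectorspace:
  fixes S :: "(('k::field, 'x) ncpoly \<times> ('k, 'x) ncpoly) set"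
  assumes rels: "\<And>l r. (l, r) \<in> S \<Longrightarrow> l \<in> carrier (free_alg X) \<and> r \<in> carrier (free_alg X)"
  shows "vectorspace class_ring (presented_alg X S)"
proof -
  interpret A: ring "presented_alg X S" using rels by (rule presented_alg_ring)
  note ops = presented_alg_ops[OF rels] and closed = free_alg_closed(3,4,6)
  have "module class_ring (presented_alg X S)"
    by (rule moduleI)
      (auto simp: presented_alg_carrier ops closed scal_add scal_mult scal_1
        distrib_left distrib_right mult.assoc fieldE(1)[OF class_field] A.abelian_group_axioms)
  then show ?thesis
    by (simp add: vectorspace_def class_field)
qed

lemma presented_alg_smult_mult:
  assumes rels: "\<And>l r. (l, r) \<in> S \<Longrightarrow> l \<in> carrier (free_alg X) \<and> r \<in> carrier (free_alg X)"
    and "a \<in> carrier (presented_alg X S)" "b \<in> carrier (presented_alg X S)"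
  shows "(c \<odot>\<^bsub>presented_alg X S\<^esub> a) \<otimes>\<^bsub>presented_alg X S\<^esub> b =
           c \<odot>\<^bsub>presented_alg X S\<^esub> (a \<otimes>\<^bsub>presented_alg X S\<^esub> b)"
    and "a \<otimes>\<^bsub>presented_alg X S\<^esub> (c \<odot>\<^bsub>presented_alg X S\<^esub> b) =
           c \<odot>\<^bsub>presented_alg X S\<^esub> (a \<otimes>\<^bsub>presented_alg X S\<^esub> b)"
proof -
  obtain p q where *: "p \<in> carrier (free_alg X)" "q \<in> carrier (free_alg X)"
      "a = cls X S p" "b = cls X S q"
    using assms(2,3) by (auto simp: presented_alg_carrier)
  note ops = presented_alg_ops[OF rels] and closed = free_alg_closed(3,6)
  show "(c \<odot>\<^bsub>presented_alg X S\<^esub> a) \<otimes>\<^bsub>presented_alg X S\<^esub> b =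
           c \<odot>\<^bsub>presented_alg X S\<^esub> (a \<otimes>\<^bsub>presented_alg X S\<^esub> b)"
    using * by (simp add: ops closed mult.assoc)
  have "p * (scal c * q) = scal c * (p * q)"
    by (metis mult.assoc scal_commute)
  then show "a \<otimes>\<^bsub>presented_alg X S\<^esub> (c \<odot>\<^bsub>presented_alg X S\<^esub> b) =
           c \<odot>\<^bsub>presented_alg X S\<^esub> (a \<otimes>\<^bsub>presented_alg X S\<^esub> b)"
    using * by (simp add: ops closed)
qed

lemma free_even_closed:
  "0 \<in> free_even X d" "1 \<in> free_even X d" "scal c \<in> free_even X d"
  "p \<in> free_even X d \<Longrightarrow> q \<in> free_even X d \<Longrightarrow> p + q \<in> free_even X d"
  "p \<in> free_even X d \<Longrightarrow> q \<in> free_even X d \<Longrightarrow> p * q \<in> free_even X d"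
proof -
  show "0 \<in> free_even X d" by (simp add: free_even_def free_alg_closed)
  show "1 \<in> free_even X d" by (simp add: free_even_def free_alg_closed zero_gword_def)
  show "scal c \<in> free_even X d"
    using keys_scal[of c] by (auto simp: free_even_def free_alg_closed zero_gword_def)
  show "p \<in> free_even X d \<Longrightarrow> q \<in> free_even X d \<Longrightarrow> p + q \<in> free_even X d"
    using Poly_Mapping.keys_add[of p q] by (auto simp: free_even_def free_alg_closed)
  show "p \<in> free_even X d \<Longrightarrow> q \<in> free_even X d \<Longrightarrow> p * q \<in> free_even X d"
    using keys_mult[of p q] by (fastforce simp: free_even_def free_alg_closed plus_gword_def)
qed

lemma even_subalg_is_subalgebra:
  fixes S :: "(('k::field, 'x) ncpoly \<times> ('k, 'x) ncpoly) set"
  assumes rels: "\<And>l r. (l, r) \<in> S \<Longrightarrow> l \<in> carrier (free_alg X) \<and> r \<in> carrier (free_alg X)"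
  fixes d :: "'x \<Rightarrow> bool"
  defines "E \<equiv> carrier (even_subalg X S d)"
  shows "subspace class_ring E (presented_alg X S)"
    and "\<one>\<^bsub>presented_alg X S\<^esub> \<in> E"
    and "a \<in> E \<Longrightarrow> b \<in> E \<Longrightarrow> a \<otimes>\<^bsub>presented_alg X S\<^esub> b \<in> E"
    and "vectorspace class_ring (even_subalg X S d)"
proof -
  interpret V: vectorspace "class_ring :: 'k ring" "presented_alg X S"
    using rels by (rule presented_alg_vectorspace)
  note ops = presented_alg_ops[OF rels]
  have E: "E = cls X S ` free_even X d" by (simp add: E_def even_subalg_def)
  have carr: "p \<in> carrier (free_alg X)" if "p \<in> free_even X d" for p :: "('k, 'x) ncpoly"
    using that by (simp add: free_even_def)
  show one: "\<one>\<^bsub>presented_alg X S\<^esub> \<in> E"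
    using presented_alg_zero_one[OF rels] imageI[OF free_even_closed(2), of "cls X S" X d] by (simp add: E)
  show "a \<in> E \<Longrightarrow> b \<in> E \<Longrightarrow> a \<otimes>\<^bsub>presented_alg X S\<^esub> b \<in> E"
    by (auto simp: E ops carr free_even_closed)
  have "submodule class_ring E (presented_alg X S)"
  proof (rule submodule.intro)
    show "module class_ring (presented_alg X S)" by (rule V.module_axioms)
    show "E \<subseteq> carrier (presented_alg X S)" by (auto simp: E presented_alg_carrier carr)
    show "\<zero>\<^bsub>presented_alg X S\<^esub> \<in> E"
      using presented_alg_zero_one[OF rels] imageI[OF free_even_closed(1), of "cls X S" X d] by (simp add: E)
  qed (auto simp: E ops carr free_even_closed)
  then show sub: "subspace class_ring E (presented_alg X S)"
    by (simp add: subspace_def V.vectorspace_axioms)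
  show "vectorspace class_ring (even_subalg X S d)"
    using V.subspace_is_vs[OF sub] by (simp add: E even_subalg_def)
qed

type_synonym Cq = "complex poly fract"

definition qq :: Cq where
  "qq = Fract [:0, 1:] 1"

definition eps :: Cq where
  "eps = qq - inverse qq"

definition spin_gens :: "nat \<Rightarrow> nat set" where
  "spin_gens n = {1..n-1}"

definition spin_rels :: "nat \<Rightarrow> ((Cq, nat) ncpoly \<times> (Cq, nat) ncpoly) set" where
  "spin_rels n =
     {(gen i * gen i, scal (- (eps^2) - 2)) | i. i \<in> {1..n-1}} \<union>
     {(gen i * gen j, - (gen j * gen i)) | i j.
        i \<in> {1..n-1} \<and> j \<in> {1..n-1} \<and> \<bar>int i - int j\<bar> > 1} \<union>
     {(gen i * gen (i+1) * gen i - gen (i+1) * gen i * gen (i+1),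
       scal (eps^2) * (gen (i+1) - gen i)) | i. i \<in> {1..n-1} \<and> i + 1 \<in> {1..n-1}}"

definition spin_hecke :: "nat \<Rightarrow> (Cq, (Cq, nat) ncpoly set) module" where
  "spin_hecke n = presented_alg (spin_gens n) (spin_rels n)"

definition spin_hecke_even :: "nat \<Rightarrow> (Cq, (Cq, nat) ncpoly set) module" where
  "spin_hecke_even n = even_subalg (spin_gens n) (spin_rels n) (\<lambda>_. True)"

definition spin_R :: "nat \<Rightarrow> nat \<Rightarrow> (Cq, nat) ncpoly set" where
  "spin_R n i = cls (spin_gens n) (spin_rels n) (gen i)"

datatype cover_gen = CZ | CT nat

definition cover_gens :: "nat \<Rightarrow> cover_gen set" where
  "cover_gens n = insert CZ (CT ` {1..n-1})"

definition cover_rels :: "nat \<Rightarrow> ((Cq, cover_gen) ncpoly \<times> (Cq, cover_gen) ncpoly) set" where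
  "cover_rels n =
     {(gen CZ * gen CZ, 1)} \<union>
     {(gen CZ * gen (CT i), gen (CT i) * gen CZ) | i. i \<in> {1..n-1}} \<union>
     {(gen (CT i) * gen (CT i), scal (qq^2 + inverse qq^2 + 1) * gen CZ + 1) | i. i \<in> {1..n-1}} \<union>
     {(gen (CT i) * gen (CT j), gen CZ * gen (CT j) * gen (CT i)) | i j.
        i \<in> {1..n-1} \<and> j \<in> {1..n-1} \<and> \<bar>int i - int j\<bar> > 1} \<union>
     {(gen (CT i) * gen (CT (i+1)) * gen (CT i) - gen (CT (i+1)) * gen (CT i) * gen (CT (i+1)),
       scal (eps^2) * (gen (CT (i+1)) - gen (CT i))) | i. i \<in> {1..n-1} \<and> i + 1 \<in> {1..n-1}}"

definition cover_hecke :: "nat \<Rightarrow> (Cq, (Cq, cover_gen) ncpoly set) module" where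
  "cover_hecke n = presented_alg (cover_gens n) (cover_rels n)"

definition cover_hecke_even :: "nat \<Rightarrow> (Cq, (Cq, cover_gen) ncpoly set) module" where
  "cover_hecke_even n = even_subalg (cover_gens n) (cover_rels n) (\<lambda>x. x \<noteq> CZ)"

definition cover_z :: "nat \<Rightarrow> (Cq, cover_gen) ncpoly set" where
  "cover_z n = cls (cover_gens n) (cover_rels n) (gen CZ)"

definition cover_T :: "nat \<Rightarrow> nat \<Rightarrow> (Cq, cover_gen) ncpoly set" where
  "cover_T n i = cls (cover_gens n) (cover_rels n) (gen (CT i))"

lemma gen_closed: "x \<in> X \<Longrightarrow> gen x \<in> carrier (free_alg X)"
  by (simp add: gen_def free_alg_def)

lemma free_alg_minus_closed:
  "p \<in> carrier (free_alg X) \<Longrightarrow> q \<in> carrier (free_alg X) \<Longrightarrow> p - q \<in> carrier (free_alg X)"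
  using free_alg_closed(4)[of p X "- q"] free_alg_closed(5)[of q X] by simp

lemma spin_rels_closed:
  "(l, r) \<in> spin_rels n \<Longrightarrow>
     l \<in> carrier (free_alg (spin_gens n)) \<and> r \<in> carrier (free_alg (spin_gens n))"
  unfolding spin_rels_def spin_gens_def
  by (auto intro!: free_alg_closed free_alg_minus_closed gen_closed)

lemma cover_rels_closed:
  "(l, r) \<in> cover_rels n \<Longrightarrow>
     l \<in> carrier (free_alg (cover_gens n)) \<and> r \<in> carrier (free_alg (cover_gens n))"
  unfolding cover_rels_def cover_gens_def
  by (auto intro!: free_alg_closed free_alg_minus_closed gen_closed)

lemma spin_hecke_algebra:
  "ring (spin_hecke n)" "vectorspace class_ring (spin_hecke n)"
  "vectorspace class_ring (spin_hecke_even n)"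
  unfolding spin_hecke_def spin_hecke_even_def
  by (rule presented_alg_ring presented_alg_vectorspace even_subalg_is_subalgebra(4),
      erule spin_rels_closed)+

lemma cover_hecke_algebra:
  "ring (cover_hecke n)" "vectorspace class_ring (cover_hecke n)"
  "vectorspace class_ring (cover_hecke_even n)"
  unfolding cover_hecke_def cover_hecke_even_def
  by (rule presented_alg_ring presented_alg_vectorspace even_subalg_is_subalgebra(4),
      erule cover_rels_closed)+

definition list_prod :: "('a, 'm) monoid_scheme \<Rightarrow> 'a list \<Rightarrow> 'a" where
  "list_prod G xs = foldr (mult G) xs (one G)"

text \<open>\<open>desc_prod G g i a = g i * g (i-1) * ... * g (i-a+1)\<close>; the subtraction on \<open>nat\<close> does not
  truncate for \<open>a \<le> i\<close>.\<close>

definition desc_prod :: "('a, 'm) monoid_scheme \<Rightarrow> (nat \<Rightarrow> 'a) \<Rightarrow> nat \<Rightarrow> nat \<Rightarrow> 'a" where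
  "desc_prod G g i a = list_prod G (map (\<lambda>j. g (i - j)) [0..<a])"

definition std_mon :: "('a, 'm) monoid_scheme \<Rightarrow> (nat \<Rightarrow> 'a) \<Rightarrow> nat \<Rightarrow> (nat \<Rightarrow> nat) \<Rightarrow> 'a" where
  "std_mon G g n a = list_prod G (map (\<lambda>i. desc_prod G g i (a i)) [1..<n])"

definition even_exps :: "nat \<Rightarrow> (nat \<Rightarrow> nat) set" where
  "even_exps n = {a \<in> PiE {1..n-1} (\<lambda>i. {0..i}). even (\<Sum>i\<in>{1..n-1}. a i)}"

text \<open>The family \<open>(f i)\<close>, \<open>i \<in> I\<close>, is a basis: in addition to its image being one, distinct indices
  give distinct vectors.\<close>

definition basis_family ::
  "('k, 'c) ring_scheme \<Rightarrow> ('k, 'v, 'd) module_scheme \<Rightarrow> ('i \<Rightarrow> 'v) \<Rightarrow> 'i set \<Rightarrow> bool" where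
  "basis_family K V f I \<longleftrightarrow> vectorspace K V \<and> inj_on f I \<and> vectorspace.basis K V (f ` I)"

end

theory Submission
  imports Defs "HOL-Library.Function_Algebras"
begin

text \<open>
Put \<open>z = -1\<close> in the relations of the covering algebra: since \<open>- (q^2 + q^(-2) + 1) + 1 = - \<epsilon>^2 - 2\<close>, the result
is the spin algebra. Put \<open>z = 1\<close>: the result is the Hecke algebra of type A with the generators \<open>2 T\<^sub>i - \<epsilon>\<close>, where
\<open>T\<^sub>i^2 = \<epsilon> T\<^sub>i + 1\<close>. Both halves of the theorem therefore come from one argument about the covering relations, in
which \<open>z\<close> is any central element of square 1.

\<^emph>\<open>Spanning.\<close> Let \<open>H\<^sub>m\<close> be generated by \<open>z\<close> and the first \<open>m - 1\<close> generators. The descending products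
\<open>D\<^sub>b = X\<^sub>m X\<^sub>m\<^sub>-\<^sub>1 \<dots>\<close> with \<open>b \<le> m\<close> factors satisfy \<open>D\<^sub>b X\<^sub>j \<in> \<Sum>\<^sub>c H\<^sub>m D\<^sub>c\<close> for every \<open>j \<le> m\<close>: either \<open>X\<^sub>j\<close>
prolongs \<open>D\<^sub>b\<close>, or it cancels against the last factor, or it slides to the left, possibly after one use of the braid
relation. So \<open>H\<^sub>m\<^sub>+\<^sub>1 = \<Sum>\<^sub>c H\<^sub>m D\<^sub>c\<close>, and induction shows that the standard monomials span over \<open>\<complex>(q)[z]\<close>. Every
relation is homogeneous, so that the parity of the length is respected throughout.

\<^emph>\<open>Independence.\<close> A faithful enough representation is needed. The isomorphism between the Hecke-Clifford algebra and
the tensor product of the Clifford algebra with the spin Hecke algebra suggests to send \<open>X\<^sub>i\<close> to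
\<open>(c\<^sub>i - c\<^sub>i\<^sub>+\<^sub>1) \<otimes> T\<^sub>i + \<epsilon> c\<^sub>i\<^sub>+\<^sub>1 \<otimes> 1\<close>, where \<open>c\<^sub>i^2 = -1\<close>, in the ordinary tensor product of a Clifford algebra
and the Hecke algebra. The covering relations with \<open>z = -1\<close> hold for these elements, and those with \<open>z = 1\<close> hold
after \<open>c\<^sub>i - c\<^sub>i\<^sub>+\<^sub>1\<close> and \<open>c\<^sub>i\<^sub>+\<^sub>1\<close> are replaced by \<open>2\<close> and \<open>-1\<close>; both cases rest on the same identities between
the two coefficients. The Hecke algebra acts on functions of words by the quantum permutation of neighbouring letters,
the Clifford algebra on functions of sets of indices. Applied to a function concentrated in the word \<open>1 2 3 \<dots>\<close>, the
standard monomials have distinct leading words, with invertible leading coefficients because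
the square of \<open>c\<^sub>i - c\<^sub>i\<^sub>+\<^sub>1\<close> is \<open>-2\<close>. A relation
\<open>\<Sum> (x\<^sub>a + y\<^sub>a z) X\<^sup>a = 0\<close> in the covering algebra gives \<open>x\<^sub>a - y\<^sub>a = 0\<close> and \<open>x\<^sub>a + y\<^sub>a = 0\<close> in the two
representations, whence \<open>x\<^sub>a = y\<^sub>a = 0\<close>.

\<^emph>\<open>Dimension.\<close> Replacing \<open>a\<^sub>1 \<in> {0, 1}\<close> by \<open>1 - a\<^sub>1\<close> exchanges the exponents of even and of odd sum, so half of the
\<open>n!\<close> exponents are even.

The main steps are \<open>even_subalg_basis\<close> (what a basis means in terms of polynomials modulo the ideal of relations),
\<open>std_span_X\<close> (spanning), \<open>twisted_hecke_braid\<close> (the representation) and \<open>std_monomial_independent\<close>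
(independence).
\<close>

section \<open>Evaluating noncommutative polynomials\<close>

definition word_prod :: "('x \<Rightarrow> 'r::ring_1) \<Rightarrow> 'x gword \<Rightarrow> 'r" where
  "word_prod \<rho> w = prod_list (map \<rho> (letters w))"

definition eval_poly :: "('k::field \<Rightarrow> 'r::ring_1) \<Rightarrow> ('x \<Rightarrow> 'r) \<Rightarrow> ('k, 'x) ncpoly \<Rightarrow> 'r" where
  "eval_poly \<kappa> \<rho> p = (\<Sum>w\<in>Poly_Mapping.keys p. \<kappa> (Poly_Mapping.lookup p w) * word_prod \<rho> w)"

lemma ncpoly_induct [case_names zero single add]:
  fixes p :: "('k::field, 'x) ncpoly"
  assumes "P 0" and "\<And>w c. P (Poly_Mapping.single w c)"
    and "\<And>p q. P p \<Longrightarrow> P q \<Longrightarrow> P (p + q)"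
  shows "P p"
proof (induction p rule: Poly_Mapping.update_induct)
  case const
  then show ?case using assms(1) by simp
next
  case (update f w d)
  have "Poly_Mapping.update w d f = f + Poly_Mapping.single w d"
    using update by (intro poly_mapping_eqI)
      (auto simp: lookup_update lookup_add lookup_single in_keys_iff when_def)
  then show ?case using assms(2,3) update by simp
qed

lemma ncpoly_eq_sum_keys:
  "p = (\<Sum>w\<in>Poly_Mapping.keys p. Poly_Mapping.single w (Poly_Mapping.lookup p w))"
  by (intro poly_mapping_eqI)
    (auto simp: lookup_sum lookup_single when_def in_keys_iff sum.delta if_distrib cong: if_cong)

lemma scal_gen_word:
  fixes c :: "'k::field" and w :: "'x gword"
  shows "Poly_Mapping.single w c = scal c * prod_list (map gen (letters w))"
proof -
  have "prod_list (map gen xs) = (Poly_Mapping.single (GWord xs) 1 :: ('k::field, 'x) ncpoly)" for xs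
    by (induction xs) (simp_all add: gen_def mult_single plus_gword_def single_one[symmetric] zero_gword_def)
  from this[of "letters w"] show ?thesis
    by (simp add: scal_def mult_single)
qed

lemma scal_uminus: "scal (- c) = - scal c"
  by (simp add: scal_def single_uminus)

lemma scal_0: "scal 0 = 0"
  by (simp add: scal_def)

text \<open>Polynomials are evaluated in a ring that carries its scalars as a subring, given by \<open>\<kappa>\<close>; a separate notion of
algebra is avoided by asking that this subring commutes with the images of the letters.\<close>
locale scalar_action =
  fixes \<kappa> :: "'k::field \<Rightarrow> 'r::ring_1" and \<rho> :: "'x \<Rightarrow> 'r"
  assumes \<kappa>_add: "\<kappa> (c + d) = \<kappa> c + \<kappa> d" and \<kappa>_mult: "\<kappa> (c * d) = \<kappa> c * \<kappa> d" and \<kappa>_one: "\<kappa> 1 = 1"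
    and \<kappa>_commute: "\<rho> x * \<kappa> c = \<kappa> c * \<rho> x"
begin

abbreviation ev :: "('k, 'x) ncpoly \<Rightarrow> 'r" where
  "ev \<equiv> eval_poly \<kappa> \<rho>"

lemma \<kappa>_zero: "\<kappa> 0 = 0"
  using \<kappa>_add[of 0 0] by simp

lemma eval_zero: "ev 0 = 0"
  by (simp add: eval_poly_def)

lemma eval_single: "ev (Poly_Mapping.single w c) = \<kappa> c * word_prod \<rho> w"
  by (simp add: eval_poly_def \<kappa>_zero)

lemma eval_superset:
  assumes "finite K" "Poly_Mapping.keys p \<subseteq> K"
  shows "ev p = (\<Sum>w\<in>K. \<kappa> (Poly_Mapping.lookup p w) * word_prod \<rho> w)"
  unfolding eval_poly_def using assms
  by (intro sum.mono_neutral_left) (auto simp: in_keys_iff \<kappa>_zero)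

lemma eval_add: "ev (p + q) = ev p + ev q"
proof -
  let ?K = "Poly_Mapping.keys p \<union> Poly_Mapping.keys q"
  have "ev (p + q) = (\<Sum>w\<in>?K. \<kappa> (Poly_Mapping.lookup (p + q) w) * word_prod \<rho> w)"
    by (rule eval_superset) (simp_all add: Poly_Mapping.keys_add)
  also have "\<dots> = ev p + ev q"
    by (simp add: eval_superset[of ?K p] eval_superset[of ?K q] lookup_add \<kappa>_add distrib_right sum.distrib)
  finally show ?thesis .
qed

lemma eval_uminus: "ev (- p) = - ev p"
  using eval_add[of "- p" p] by (simp add: eval_zero eq_neg_iff_add_eq_0)

lemma eval_diff: "ev (p - q) = ev p - ev q"
  using eval_add[of p "- q"] by (simp add: eval_uminus)

lemma word_prod_commute: "word_prod \<rho> w * \<kappa> c = \<kappa> c * word_prod \<rho> w"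
proof -
  have "prod_list (map \<rho> xs) * \<kappa> c = \<kappa> c * prod_list (map \<rho> xs)" for xs
  proof (induction xs)
    case (Cons x xs)
    then show ?case using \<kappa>_commute[of x c] by (simp add: mult.assoc) (simp add: mult.assoc[symmetric])
  qed simp
  then show ?thesis by (simp add: word_prod_def)
qed

lemma eval_mult: "ev (p * q) = ev p * ev q"
proof (induction p rule: ncpoly_induct)
  case (single v c)
  show ?case
  proof (induction q rule: ncpoly_induct)
    case (single w d)
    have "word_prod \<rho> v * (\<kappa> d * word_prod \<rho> w) = \<kappa> d * (word_prod \<rho> v * word_prod \<rho> w)"
      by (metis mult.assoc word_prod_commute)
    then show ?case
      by (simp add: mult_single eval_single \<kappa>_mult mult.assoc)
        (simp add: word_prod_def plus_gword_def)
  qed (simp_all add: eval_zero eval_add distrib_left)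
qed (simp_all add: eval_zero eval_add distrib_right)

lemma eval_scal: "ev (scal c) = \<kappa> c"
  by (simp add: scal_def eval_single word_prod_def zero_gword_def)

lemma eval_gen: "ev (gen x) = \<rho> x"
  by (simp add: gen_def eval_single word_prod_def \<kappa>_one)

lemma eval_one: "ev 1 = 1"
  using eval_scal[of 1] by (simp add: scal_1 \<kappa>_one)

lemma eval_sum: "ev (sum f I) = (\<Sum>i\<in>I. ev (f i))"
  by (induction I rule: infinite_finite_induct) (simp_all add: eval_zero eval_add)

lemma eval_prod_list: "ev (prod_list ps) = prod_list (map ev ps)"
  by (induction ps) (simp_all add: eval_one eval_mult)

lemmas eval_simps = eval_zero eval_one eval_add eval_diff eval_uminus eval_mult eval_scal eval_gen

text \<open>The polynomials of value 0 form an ideal that contains the relations: this is how a representation of a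
presented algebra arises.\<close>
lemma eval_rel_ideal:
  assumes rels: "\<And>l r. (l, r) \<in> S \<Longrightarrow> l \<in> carrier (free_alg X) \<and> r \<in> carrier (free_alg X)"
    and eq: "\<And>l r. (l, r) \<in> S \<Longrightarrow> ev l = ev r"
    and p: "p \<in> rel_ideal X S"
  shows "ev p = 0"
proof -
  let ?N = "{p \<in> carrier (free_alg X). ev p = 0}"
  interpret F: ring "free_alg X :: ('k, ('k, 'x) ncpoly) module" by (rule free_alg_ring)
  have a_inv: "\<ominus>\<^bsub>free_alg X\<^esub> q = - q" if "q \<in> carrier (free_alg X)" for q :: "('k, 'x) ncpoly"
    using that by (intro F.minus_equality) (simp_all add: free_alg_closed)
  have "ideal ?N (free_alg X)"
  proof (rule idealI)
    show "ring (free_alg X :: ('k, ('k, 'x) ncpoly) module)" by (rule free_alg_ring)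
    show "subgroup ?N (add_monoid (free_alg X))"
    proof (rule F.add.subgroupI)
      show "?N \<noteq> {}" using eval_zero free_alg_closed(1)[of X] by blast
      fix a assume "a \<in> ?N"
      then show "\<ominus>\<^bsub>free_alg X\<^esub> a \<in> ?N"
        by (simp add: a_inv free_alg_closed eval_uminus)
    qed (auto simp: free_alg_closed eval_simps)
  qed (auto simp: free_alg_closed eval_simps)
  moreover have "{l - r | l r. (l, r) \<in> S} \<subseteq> ?N"
    using rels eq by (auto simp: eval_diff free_alg_minus_closed)
  ultimately have "rel_ideal X S \<subseteq> ?N"
    unfolding rel_ideal_def by (rule F.genideal_minimal)
  then show ?thesis using p by auto
qed

end

section \<open>Bases of the even part of a presented algebra\<close>

lemma cls_eq_iff:
  assumes rels: "\<And>l r. (l, r) \<in> S \<Longrightarrow> l \<in> carrier (free_alg X) \<and> r \<in> carrier (free_alg X)"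
    and p: "p \<in> carrier (free_alg X)" and q: "q \<in> carrier (free_alg X)"
  shows "cls X S p = cls X S q \<longleftrightarrow> p - q \<in> rel_ideal X S"
proof
  interpret I: ideal "rel_ideal X S" "free_alg X" using rels by (rule rel_ideal_ideal)
  show "p - q \<in> rel_ideal X S" if "cls X S p = cls X S q"
  proof -
    have "p \<in> cls X S q" using I.a_rcos_self[OF p] that by (simp add: cls_def)
    then show ?thesis by (auto simp: cls_def a_r_coset_def')
  qed
  show "cls X S p = cls X S q" if d: "p - q \<in> rel_ideal X S"
  proof -
    have "p \<in> cls X S q"
      unfolding cls_def a_r_coset_def' using d by (auto intro!: bexI[of _ "p - q"])
    then show ?thesis
      using I.a_repr_independence[OF _ q I.a_subgroup, of p] by (simp add: cls_def)
  qed
qed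

text \<open>The map to the quotient is linear, so independence and spanning may be tested on representatives, modulo the
ideal of relations. Injectivity of the family comes for free: two equal members would be a dependency with the
coefficients \<open>1\<close> and \<open>-1\<close>.\<close>
lemma even_subalg_basis:
  fixes S :: "(('k::field, 'x) ncpoly \<times> ('k, 'x) ncpoly) set"
  assumes rels: "\<And>l r. (l, r) \<in> S \<Longrightarrow> l \<in> carrier (free_alg X) \<and> r \<in> carrier (free_alg X)"
    and fin: "finite I" and even: "\<And>i. i \<in> I \<Longrightarrow> F i \<in> free_even X d"
    and indep: "\<And>c. (\<Sum>i\<in>I. scal (c i) * F i) \<in> rel_ideal X S \<Longrightarrow> \<forall>i\<in>I. c i = 0"
    and gen: "\<And>p. p \<in> free_even X d \<Longrightarrow> \<exists>c. p - (\<Sum>i\<in>I. scal (c i) * F i) \<in> rel_ideal X S"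
  shows "basis_family class_ring (even_subalg X S d) (\<lambda>i. cls X S (F i)) I"
    and "vectorspace.dim class_ring (even_subalg X S d) = card I"
proof -
  interpret V: vectorspace "class_ring :: 'k ring" "even_subalg X S d"
    by (rule even_subalg_is_subalgebra(4)[OF rels])
  let ?f = "\<lambda>i. cls X S (F i)"
  have carr: "p \<in> carrier (free_alg X)" if "p \<in> free_even X d" for p :: "('k, 'x) ncpoly"
    using that by (simp add: free_even_def)
  have Ecarr: "carrier (even_subalg X S d) = cls X S ` free_even X d"
    by (simp add: even_subalg_def)
  have zero: "\<zero>\<^bsub>even_subalg X S d\<^esub> = cls X S 0"
    using presented_alg_zero_one(1)[OF rels] by (simp add: even_subalg_def)
  have add: "cls X S p \<oplus>\<^bsub>even_subalg X S d\<^esub> cls X S q = cls X S (p + q)"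
    if "p \<in> free_even X d" "q \<in> free_even X d" for p q
    using presented_alg_ops(2)[OF rels carr carr] that by (simp add: even_subalg_def)
  have smult: "c \<odot>\<^bsub>even_subalg X S d\<^esub> cls X S p = cls X S (scal c * p)" if "p \<in> free_even X d" for c p
    using presented_alg_ops(4)[OF rels carr] that by (simp add: even_subalg_def)
  have sF: "scal c * F i \<in> free_even X d" if "i \<in> I" for c i
    using that even free_even_closed by blast
  have sum_even: "(\<Sum>i\<in>J. scal (c i) * F i) \<in> free_even X d" if "J \<subseteq> I" for J c
    using that by (induction J rule: infinite_finite_induct) (auto simp: free_even_closed sF)
  have inj: "inj_on ?f I"
  proof (rule inj_onI, rule ccontr)
    fix i j assume ij: "i \<in> I" "j \<in> I" "?f i = ?f j" "i \<noteq> j"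
    define c :: "'a \<Rightarrow> 'k" where "c k = (if k = i then 1 else if k = j then - 1 else 0)" for k
    have "(\<Sum>k\<in>I. scal (c k) * F k) = (\<Sum>k\<in>{i, j}. scal (c k) * F k)"
      using fin ij by (intro sum.mono_neutral_right) (auto simp: c_def scal_def)
    also have "\<dots> = F i - F j"
      using ij by (simp add: c_def scal_1 scal_uminus)
    also have "\<dots> \<in> rel_ideal X S"
      using ij(3) cls_eq_iff[OF rels carr[OF even[OF ij(1)]] carr[OF even[OF ij(2)]]] by blast
    finally have "c i = 0" using indep ij(1) by blast
    then show False by (simp add: c_def)
  qed
  have finsum: "V.lincomb a (?f ` J) = cls X S (\<Sum>i\<in>J. scal (a (?f i)) * F i)" if "J \<subseteq> I" for a J
  proof -
    have "finite J" using that fin finite_subset by blast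
    then show ?thesis using that
    proof (induction J rule: finite_induct)
      case empty
      then show ?case by (simp add: V.lincomb_def zero)
    next
      case (insert i J)
      have i: "i \<in> I" and J: "J \<subseteq> I" using insert by auto
      have ni: "?f i \<notin> ?f ` J" using inj insert(2) i J by (auto simp: inj_on_def)
      have car: "a v \<odot>\<^bsub>even_subalg X S d\<^esub> v \<in> carrier (even_subalg X S d)" if "v \<in> ?f ` I" for v
        using that even sF by (auto simp: Ecarr smult)
      have "V.lincomb a (?f ` insert i J) =
          (a (?f i) \<odot>\<^bsub>even_subalg X S d\<^esub> ?f i) \<oplus>\<^bsub>even_subalg X S d\<^esub> V.lincomb a (?f ` J)"
        unfolding V.lincomb_def image_insert
        using insert(1) ni i J car by (intro V.finsum_insert) (auto simp: image_subset_iff)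
      also have "\<dots> = cls X S (scal (a (?f i)) * F i) \<oplus>\<^bsub>even_subalg X S d\<^esub>
          cls X S (\<Sum>i\<in>J. scal (a (?f i)) * F i)"
        using insert.IH[OF J] i even by (simp add: smult)
      also have "\<dots> = cls X S (\<Sum>i\<in>insert i J. scal (a (?f i)) * F i)"
        using insert(1,2) by (simp add: add sF[OF i] sum_even[OF J])
      finally show ?case .
    qed
  qed
  have sub: "?f ` I \<subseteq> carrier (even_subalg X S d)"
    using even by (auto simp: Ecarr)
  have li: "V.lin_indpt (?f ` I)"
  proof
    assume "V.lin_dep (?f ` I)"
    then obtain A a v where A: "finite A" "A \<subseteq> ?f ` I" "V.lincomb a A = \<zero>\<^bsub>even_subalg X S d\<^esub>" "v \<in> A" "a v \<noteq> 0"
      unfolding V.lin_dep_def by auto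
    from A(2) obtain J where J: "J \<subseteq> I" "A = ?f ` J" by (meson subset_imageE)
    define c where "c i = (if i \<in> J then a (?f i) else 0)" for i
    have "(\<Sum>i\<in>I. scal (c i) * F i) = (\<Sum>i\<in>J. scal (a (?f i)) * F i)"
      using fin J by (intro sum.mono_neutral_cong_right) (auto simp: c_def scal_def)
    moreover have "cls X S (\<Sum>i\<in>J. scal (a (?f i)) * F i) = cls X S 0"
      using A(3) finsum[OF J(1)] by (simp add: J(2) zero)
    ultimately have "(\<Sum>i\<in>I. scal (c i) * F i) \<in> rel_ideal X S"
      using cls_eq_iff[OF rels carr[OF sum_even[OF J(1)]] free_alg_closed(1)] by simp
    then have "\<forall>i\<in>I. c i = 0" by (rule indep)
    moreover obtain i where "i \<in> J" "v = ?f i" using A(4) J(2) by auto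
    ultimately have "a v = 0" using J(1) unfolding c_def by (metis subsetD)
    then show False using A(5) by simp
  qed
  have span: "V.gen_set (?f ` I)"
  proof
    show "V.span (?f ` I) \<subseteq> carrier (even_subalg X S d)"
      by (rule V.span_is_subset2[OF sub])
    show "carrier (even_subalg X S d) \<subseteq> V.span (?f ` I)"
    proof
      fix v assume "v \<in> carrier (even_subalg X S d)"
      then obtain p where p: "p \<in> free_even X d" "v = cls X S p" by (auto simp: Ecarr)
      obtain c where c: "p - (\<Sum>i\<in>I. scal (c i) * F i) \<in> rel_ideal X S"
        using gen[OF p(1)] by blast
      define a where "a w = c (the_inv_into I ?f w)" for w
      have a: "a (?f i) = c i" if "i \<in> I" for i
        using the_inv_into_f_f[OF inj that] by (simp add: a_def)
      have "v = V.lincomb a (?f ` I)"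
        using c cls_eq_iff[OF rels carr[OF p(1)] carr[OF sum_even[of I c]]] a
        by (simp add: finsum p(2))
      then show "v \<in> V.span (?f ` I)"
        unfolding V.span_def using fin by (auto simp: class_ring_simps)
    qed
  qed
  have basis: "V.basis (?f ` I)"
    unfolding V.basis_def using li span sub by auto
  show "basis_family class_ring (even_subalg X S d) ?f I"
    unfolding basis_family_def using inj basis V.vectorspace_axioms by blast
  show "V.dim = card I"
    using V.dim_basis[OF _ basis] fin card_image[OF inj] by simp
qed

section \<open>Standard monomials\<close>

text \<open>These are \<^const>\<open>desc_prod\<close> and \<^const>\<open>std_mon\<close> for the multiplication of a type class. They are
formed both of polynomials and of operators, and evaluation carries the ones to the others.\<close>
definition desc_product :: "(nat \<Rightarrow> 'r::monoid_mult) \<Rightarrow> nat \<Rightarrow> nat \<Rightarrow> 'r" where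
  "desc_product g i a = prod_list (map (\<lambda>j. g (i - j)) [0..<a])"

definition std_monomial :: "(nat \<Rightarrow> 'r::monoid_mult) \<Rightarrow> nat \<Rightarrow> (nat \<Rightarrow> nat) \<Rightarrow> 'r" where
  "std_monomial g n a = prod_list (map (\<lambda>i. desc_product g i (a i)) [1..<n])"

lemma desc_product_0 [simp]: "desc_product g i 0 = 1"
  by (simp add: desc_product_def)

lemma desc_product_Suc: "desc_product g i (Suc a) = desc_product g i a * g (i - a)"
  by (simp add: desc_product_def)

lemma desc_product_add: "desc_product g i (a + b) = desc_product g i a * desc_product g (i - a) b"
  by (induction b) (simp_all add: desc_product_Suc mult.assoc)

lemma desc_product_Suc_left: "desc_product g i (Suc a) = g i * desc_product g (i - 1) a"
  using desc_product_add[of g i 1 a] by (simp add: desc_product_Suc)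

lemma std_monomial_1 [simp]: "std_monomial g (Suc 0) a = 1"
  by (simp add: std_monomial_def)

lemma std_monomial_Suc: "1 \<le> n \<Longrightarrow> std_monomial g (Suc n) a = std_monomial g n a * desc_product g n (a n)"
  by (simp add: std_monomial_def)

lemma std_monomial_cong: "(\<And>i. 1 \<le> i \<Longrightarrow> i < n \<Longrightarrow> a i = b i) \<Longrightarrow> std_monomial g n a = std_monomial g n b"
  unfolding std_monomial_def by (intro arg_cong[of _ _ prod_list] map_cong) auto

definition free_parity :: "'x set \<Rightarrow> ('x \<Rightarrow> bool) \<Rightarrow> bool \<Rightarrow> ('k::field, 'x) ncpoly set" where
  "free_parity A d \<pi> = {p \<in> carrier (free_alg A).
     \<forall>w\<in>Poly_Mapping.keys p. even (length (filter d (letters w))) = \<pi>}"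

lemma free_parity_even: "free_parity A d True = free_even A d"
  by (simp add: free_parity_def free_even_def)

lemma free_parity_mult:
  assumes "p \<in> free_parity A d \<pi>" "q \<in> free_parity A d \<sigma>"
  shows "p * q \<in> free_parity A d (\<pi> = \<sigma>)"
proof -
  have "even (length (filter d (letters w))) = (\<pi> = \<sigma>)" if "w \<in> Poly_Mapping.keys (p * q)" for w
  proof -
    from that keys_mult[of p q] obtain u v where
      "w = u + v" "u \<in> Poly_Mapping.keys p" "v \<in> Poly_Mapping.keys q" by blast
    moreover from this have "even (length (filter d (letters u))) = \<pi>" "even (length (filter d (letters v))) = \<sigma>"
      using assms by (simp_all add: free_parity_def)
    ultimately show ?thesis by (simp add: plus_gword_def)
  qed
  then show ?thesis using assms by (simp add: free_parity_def free_alg_closed)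
qed

lemma free_parity_gen: "x \<in> A \<Longrightarrow> d x \<Longrightarrow> gen x \<in> free_parity A d False"
  by (simp add: free_parity_def gen_closed) (simp add: gen_def)

lemma free_parity_desc_product:
  assumes "\<And>i. 1 \<le> i \<Longrightarrow> i < n \<Longrightarrow> g i \<in> free_parity A d False" "i < n" "a \<le> i"
  shows "desc_product g i a \<in> free_parity A d (even a)"
  using assms(3)
proof (induction a)
  case 0
  then show ?case using free_even_closed(2) by (simp add: free_parity_even)
next
  case (Suc a)
  have "g (i - a) \<in> free_parity A d False" using assms Suc by auto
  from free_parity_mult[OF Suc.IH this] Suc show ?case by (simp add: desc_product_Suc)
qed

lemma free_parity_std_monomial:
  assumes "\<And>i. 1 \<le> i \<Longrightarrow> i < n \<Longrightarrow> g i \<in> free_parity A d False" "\<And>i. 1 \<le> i \<Longrightarrow> i < n \<Longrightarrow> a i \<le> i" "1 \<le> n"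
  shows "std_monomial g n a \<in> free_parity A d (even (\<Sum>i=1..<n. a i))"
proof -
  have "m \<le> n \<Longrightarrow> std_monomial g m a \<in> free_parity A d (even (\<Sum>i=1..<m. a i))" if "1 \<le> m" for m
    using that
  proof (induction m rule: dec_induct)
    case base
    then show ?case using free_even_closed(2) by (simp add: free_parity_even)
  next
    case (step m)
    have "desc_product g m (a m) \<in> free_parity A d (even (a m))"
      using assms step by (intro free_parity_desc_product[of n]) auto
    from free_parity_mult[OF _ this, of "std_monomial g m a"] step show ?case by (simp add: std_monomial_Suc)
  qed
  then show ?thesis using assms(3) by simp
qed

text \<open>An even polynomial is a sum of even words, but the initial parts of an even word can be odd; hence the
induction runs over both parities at once.\<close>
lemma free_even_induct:
  fixes L :: "bool \<Rightarrow> ('k::field, 'x) ncpoly set"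
  assumes p: "p \<in> free_even A d"
    and zero: "0 \<in> L True"
    and add: "\<And>p q. p \<in> L True \<Longrightarrow> q \<in> L True \<Longrightarrow> p + q \<in> L True"
    and scal: "\<And>c. scal c \<in> L True"
    and gen: "\<And>p x \<pi>. p \<in> L \<pi> \<Longrightarrow> x \<in> A \<Longrightarrow> p * gen x \<in> L (\<pi> = (\<not> d x))"
  shows "p \<in> L True"
proof -
  have word: "set xs \<subseteq> A \<Longrightarrow> scal c * prod_list (map gen xs) \<in> L (even (length (filter d xs)))" for c xs
  proof (induction xs rule: rev_induct)
    case Nil
    then show ?case by (simp add: scal)
  next
    case (snoc x xs)
    then have "(scal c * prod_list (map gen xs)) * gen x \<in> L (even (length (filter d xs)) = (\<not> d x))"
      by (intro gen) auto
    then show ?case by (auto simp: mult.assoc split: if_splits)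
  qed
  have "Poly_Mapping.single w (Poly_Mapping.lookup p w) \<in> L True" if "w \<in> Poly_Mapping.keys p" for w
    using word[of "letters w" "Poly_Mapping.lookup p w"] that p
    by (auto simp: scal_gen_word free_even_def free_alg_def)
  then have "(\<Sum>w\<in>K. Poly_Mapping.single w (Poly_Mapping.lookup p w)) \<in> L True"
    if "K \<subseteq> Poly_Mapping.keys p" for K
    using that by (induction K rule: infinite_finite_induct) (auto simp: zero add)
  from this[of "Poly_Mapping.keys p"] show ?thesis
    using ncpoly_eq_sum_keys[of p] by simp
qed

lemma std_mon_presented_alg:
  assumes rels: "\<And>l r. (l, r) \<in> S \<Longrightarrow> l \<in> carrier (free_alg A) \<and> r \<in> carrier (free_alg A)"
    and g: "\<And>i. 1 \<le> i \<Longrightarrow> i < n \<Longrightarrow> g i \<in> carrier (free_alg A)"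
    and a: "\<And>i. 1 \<le> i \<Longrightarrow> i < n \<Longrightarrow> a i \<le> i"
  shows "std_mon (presented_alg A S) (\<lambda>i. cls A S (g i)) n a = cls A S (std_monomial g n a)"
proof -
  have list: "list_prod (presented_alg A S) (map (\<lambda>x. cls A S (f x)) xs) = cls A S (prod_list (map f xs))
      \<and> prod_list (map f xs) \<in> carrier (free_alg A)"
    if "\<And>x. x \<in> set xs \<Longrightarrow> f x \<in> carrier (free_alg A)" for f and xs :: "nat list"
    using that
  proof (induction xs)
    case Nil
    then show ?case
      by (simp add: list_prod_def presented_alg_zero_one(2)[OF rels] free_alg_closed)
  next
    case (Cons x xs)
    then show ?case
      by (simp add: list_prod_def presented_alg_ops(3)[OF rels] free_alg_closed)
  qed
  have desc_product: "desc_prod (presented_alg A S) (\<lambda>i. cls A S (g i)) i (a i) = cls A S (desc_product g i (a i))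
      \<and> desc_product g i (a i) \<in> carrier (free_alg A)" if "i \<in> set [1..<n]" for i
  proof -
    have "g (i - j) \<in> carrier (free_alg A)" if "j \<in> set [0..<a i]" for j
      using that \<open>i \<in> _\<close> a[of i] by (intro g) auto
    then show ?thesis
      unfolding desc_prod_def desc_product_def by (intro list) auto
  qed
  then have map_eq: "map (\<lambda>i. desc_prod (presented_alg A S) (\<lambda>i. cls A S (g i)) i (a i)) [1..<n] =
      map (\<lambda>i. cls A S (desc_product g i (a i))) [1..<n]"
    by (intro map_cong) auto
  show ?thesis
    unfolding std_mon_def std_monomial_def map_eq
    using list[of "[1..<n]" "\<lambda>i. desc_product g i (a i)"] desc_product by (auto simp only:)
qed

lemma finite_even_exps: "finite (even_exps n)"
  by (rule finite_subset[of _ "PiE {1..n-1} (\<lambda>i. {0..i})"]) (auto simp: even_exps_def intro!: finite_PiE)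

section \<open>Standard monomials span\<close>

text \<open>The covering relations modulo an ideal, with \<open>z\<close> a polynomial rather than a letter, so that \<open>z = -1\<close> is the
spin algebra. Calculations take place in the free algebra modulo \<open>J\<close>, where associativity and distributivity
hold as they do in any ring type.\<close>
locale covering_relations =
  fixes A :: "'x set" and J :: "('k::field, 'x) ncpoly set" and z :: "('k, 'x) ncpoly"
    and X :: "nat \<Rightarrow> ('k, 'x) ncpoly" and \<theta> \<eta> :: 'k and n :: nat
  assumes J_ideal: "ideal J (free_alg A)"
    and z_closed: "z \<in> carrier (free_alg A)"
    and X_closed: "1 \<le> i \<Longrightarrow> i < n \<Longrightarrow> X i \<in> carrier (free_alg A)"
    and z_square: "z * z - 1 \<in> J"
    and z_central: "p \<in> carrier (free_alg A) \<Longrightarrow> z * p - p * z \<in> J"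
    and X_square: "1 \<le> i \<Longrightarrow> i < n \<Longrightarrow> X i * X i - (scal \<theta> * z + 1) \<in> J"
    and X_commute: "1 \<le> i \<Longrightarrow> i < n \<Longrightarrow> 1 \<le> j \<Longrightarrow> j < n \<Longrightarrow> \<bar>int i - int j\<bar> > 1 \<Longrightarrow>
        X i * X j - z * X j * X i \<in> J"
    and X_braid: "1 \<le> i \<Longrightarrow> Suc i < n \<Longrightarrow>
        X i * X (Suc i) * X i - X (Suc i) * X i * X (Suc i) - scal \<eta> * (X (Suc i) - X i) \<in> J"
begin

abbreviation C :: "('k, 'x) ncpoly set" where "C \<equiv> carrier (free_alg A)"

text \<open>Membership in the carrier is part of the congruence. It then is compatible with products without side
conditions, since \<open>J\<close> absorbs only elements of the carrier.\<close>
definition cong :: "('k, 'x) ncpoly \<Rightarrow> ('k, 'x) ncpoly \<Rightarrow> bool" (infix "\<approx>" 50) where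
  "p \<approx> q \<longleftrightarrow> p \<in> C \<and> q \<in> C \<and> p - q \<in> J"

lemma J_props:
  shows J_sub: "p \<in> J \<Longrightarrow> p \<in> C" and J_zero: "0 \<in> J"
    and J_add: "p \<in> J \<Longrightarrow> q \<in> J \<Longrightarrow> p + q \<in> J"
    and J_lmult: "p \<in> J \<Longrightarrow> r \<in> C \<Longrightarrow> r * p \<in> J"
    and J_rmult: "p \<in> J \<Longrightarrow> r \<in> C \<Longrightarrow> p * r \<in> J"
    and J_uminus: "p \<in> J \<Longrightarrow> - p \<in> J"
proof -
  interpret I: ideal J "free_alg A" by (rule J_ideal)
  show "p \<in> J \<Longrightarrow> p \<in> C" by (rule I.Icarr)
  show "0 \<in> J" using additive_subgroup.zero_closed[OF I.is_additive_subgroup] by simp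
  show "p \<in> J \<Longrightarrow> q \<in> J \<Longrightarrow> p + q \<in> J" using additive_subgroup.a_closed[OF I.is_additive_subgroup] by simp
  show l: "p \<in> J \<Longrightarrow> r \<in> C \<Longrightarrow> r * p \<in> J" for r p using I.I_l_closed by simp
  show "p \<in> J \<Longrightarrow> r \<in> C \<Longrightarrow> p * r \<in> J" using I.I_r_closed by simp
  show "p \<in> J \<Longrightarrow> - p \<in> J" using l[OF _ free_alg_closed(3), of p "- 1"]
    by (simp add: scal_uminus scal_1)
qed

lemmas C_closed [simp] = free_alg_closed[where X = A] free_alg_minus_closed[where X = A] z_closed X_closed

lemma cong_closed: "p \<approx> q \<Longrightarrow> p \<in> C" "p \<approx> q \<Longrightarrow> q \<in> C"
  by (simp_all add: cong_def)

lemma cong_refl: "p \<in> C \<Longrightarrow> p \<approx> p"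
  by (simp add: cong_def J_zero)

lemma cong_sym: "p \<approx> q \<Longrightarrow> q \<approx> p"
  using J_uminus[of "p - q"] by (simp add: cong_def)

lemma cong_trans [trans]: "p \<approx> q \<Longrightarrow> q \<approx> r \<Longrightarrow> p \<approx> r"
  using J_add[of "p - q" "q - r"] by (simp add: cong_def)

lemma cong_add: "p \<approx> q \<Longrightarrow> r \<approx> s \<Longrightarrow> p + r \<approx> q + s"
  using J_add[of "p - q" "r - s"] by (simp add: cong_def algebra_simps)

lemma cong_mult:
  assumes "p \<approx> q" "r \<approx> s"
  shows "p * r \<approx> q * s"
proof -
  have "(p - q) * r + q * (r - s) \<in> J"
    using assms by (intro J_add J_lmult J_rmult) (auto simp: cong_def)
  then show ?thesis using assms by (simp add: cong_def algebra_simps)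
qed

lemma cong_lmult: "p \<approx> q \<Longrightarrow> r \<in> C \<Longrightarrow> r * p \<approx> r * q"
  by (intro cong_mult cong_refl)

lemma cong_rmult: "p \<approx> q \<Longrightarrow> r \<in> C \<Longrightarrow> p * r \<approx> q * r"
  by (intro cong_mult cong_refl)

lemma zpow_closed [simp]: "z ^ k \<in> C"
  by (induction k) simp_all

lemma zpow_central: "p \<in> C \<Longrightarrow> z ^ k * p \<approx> p * z ^ k"
proof (induction k)
  case (Suc k)
  have "z ^ Suc k * p = z * (z ^ k * p)" by (simp add: mult.assoc)
  also have "\<dots> \<approx> z * (p * z ^ k)" by (intro cong_lmult Suc) simp
  also have "\<dots> = (z * p) * z ^ k" by (simp add: mult.assoc)
  also have "\<dots> \<approx> (p * z) * z ^ k" using Suc z_central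
    by (intro cong_rmult) (simp_all add: cong_def)
  finally show ?case by (simp add: mult.assoc)
qed (simp add: cong_refl)

text \<open>The image of \<open>k[z]\<close>: coefficients \<open>x + y z\<close> suffice because \<open>z\<^sup>2 = 1\<close> modulo \<open>J\<close>.\<close>
definition scalars :: "('k, 'x) ncpoly set" where
  "scalars = {p. \<exists>x y. p \<approx> scal x + scal y * z}"

lemma scalarsI: "p \<approx> scal x + scal y * z \<Longrightarrow> p \<in> scalars"
  unfolding scalars_def by blast

lemma scalars_closed: "s \<in> scalars \<Longrightarrow> s \<in> C"
  by (auto simp: scalars_def cong_def)

lemma scalars_scal: "scal c \<in> scalars"
  by (rule scalarsI[of _ c 0]) (simp add: scal_0 cong_refl)

lemma scalars_z: "z \<in> scalars"
  by (rule scalarsI[of _ 0 1]) (simp add: scal_0 scal_1 cong_refl)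

lemma scalars_add:
  assumes "s \<in> scalars" "t \<in> scalars"
  shows "s + t \<in> scalars"
proof -
  from assms obtain x y x' y' where "s \<approx> scal x + scal y * z" "t \<approx> scal x' + scal y' * z"
    unfolding scalars_def by blast
  from cong_add[OF this] have "s + t \<approx> scal (x + x') + scal (y + y') * z"
    by (simp add: scal_add algebra_simps)
  then show ?thesis unfolding scalars_def by blast
qed

lemma scalars_mult:
  assumes "s \<in> scalars" "t \<in> scalars"
  shows "s * t \<in> scalars"
proof -
  from assms obtain x y x' y' where "s \<approx> scal x + scal y * z" "t \<approx> scal x' + scal y' * z"
    unfolding scalars_def by blast
  from cong_mult[OF this]
  have "s * t \<approx> (scal x + scal y * z) * (scal x' + scal y' * z)" .
  also have "\<dots> = scal (x * x') + scal (x * y' + y * x') * z + scal (y * y') * (z * z)"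
  proof -
    have "z * scal x' = scal x' * z"
      by (simp only: scal_commute)
    moreover have "z * (scal y' * z) = scal y' * (z * z)"
      using scal_commute[of y' z] by (metis mult.assoc)
    ultimately show ?thesis
      by (simp add: scal_add scal_mult distrib_left distrib_right mult.assoc add.assoc)
  qed
  also have "\<dots> \<approx> scal (x * x') + scal (x * y' + y * x') * z + scal (y * y') * 1"
    using z_square by (intro cong_add cong_refl cong_lmult) (simp_all add: cong_def)
  also have "\<dots> = scal (x * x' + y * y') + scal (x * y' + y * x') * z"
    by (simp add: scal_add)
  finally show ?thesis unfolding scalars_def by blast
qed

lemma scalars_zpow: "z ^ k \<in> scalars"
  using scalars_scal[of 1] by (induction k) (simp_all add: scal_1 scalars_mult scalars_z)

lemma scalars_central:
  assumes "s \<in> scalars" "p \<in> C"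
  shows "s * p \<approx> p * s"
proof -
  from assms obtain x y where s: "s \<approx> scal x + scal y * z"
    unfolding scalars_def by blast
  have "s * p \<approx> (scal x + scal y * z) * p" by (intro cong_rmult s assms)
  also have "\<dots> = scal x * p + scal y * (z * p)" by (simp add: algebra_simps)
  also have "\<dots> \<approx> scal x * p + scal y * (p * z)"
    using assms z_central by (intro cong_add cong_refl cong_lmult) (simp_all add: cong_def)
  also have "\<dots> = p * (scal x + scal y * z)"
  proof -
    have "p * scal x = scal x * p" "p * (scal y * z) = scal y * (p * z)"
      by (simp_all only: scal_commute[of x p] mult.assoc[symmetric] scal_commute[of y p])
    then show ?thesis by (simp only: distrib_left)
  qed
  also have "\<dots> \<approx> p * s" by (intro cong_lmult cong_sym[OF s] assms)
  finally show ?thesis .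
qed

lemma X_swap:
  assumes "1 \<le> i" "i < n" "1 \<le> j" "j < n" "\<bar>int i - int j\<bar> > 1"
  shows "X i * X j \<approx> z * X j * X i"
  using assms X_commute[of i j] by (simp add: cong_def)

lemma desc_product_closed [simp]: "k < n \<Longrightarrow> a \<le> k \<Longrightarrow> desc_product X k a \<in> C"
  by (induction a) (simp_all add: desc_product_Suc)

lemma std_monomial_closed:
  assumes "1 \<le> m" "m \<le> n" "\<And>i. 1 \<le> i \<Longrightarrow> i < m \<Longrightarrow> a i \<le> i"
  shows "std_monomial X m a \<in> C"
  using assms by (induction m rule: dec_induct) (simp_all add: std_monomial_Suc)

lemma desc_product_commute_X:
  assumes k: "k < n" and c: "c \<le> k" and j: "1 \<le> j" "j < n"
    and far: "\<And>i. i < c \<Longrightarrow> \<bar>int (k - i) - int j\<bar> > 1"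
  shows "desc_product X k c * X j \<approx> z ^ c * X j * desc_product X k c"
  using c far
proof (induction c)
  case 0
  then show ?case using j by (simp add: cong_refl)
next
  case (Suc c)
  let ?x = "X (k - c)"
  have x: "?x \<in> C" using Suc k by simp
  have "desc_product X k (Suc c) * X j = desc_product X k c * (?x * X j)"
    by (simp add: desc_product_Suc mult.assoc)
  also have "\<dots> \<approx> desc_product X k c * (z * X j * ?x)"
    using Suc k j by (intro cong_lmult X_swap) auto
  also have "\<dots> = (desc_product X k c * z) * (X j * ?x)" by (simp add: mult.assoc)
  also have "\<dots> \<approx> (z * desc_product X k c) * (X j * ?x)"
    using Suc j k x by (intro cong_rmult cong_sym[OF scalars_central[OF scalars_z]]) simp_all
  also have "\<dots> = z * (desc_product X k c * X j) * ?x" by (simp add: mult.assoc)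
  also have "\<dots> \<approx> z * (z ^ c * X j * desc_product X k c) * ?x"
    using Suc x by (intro cong_rmult cong_lmult Suc.IH) simp_all
  also have "\<dots> = z ^ Suc c * X j * desc_product X k (Suc c)" by (simp add: desc_product_Suc mult.assoc)
  finally show ?case .
qed

lemma desc_product_commute_desc_product:
  assumes m: "m < n" and d: "k + d < m" and c: "c \<le> k"
  shows "desc_product X m d * desc_product X k c \<approx> z ^ (d * c) * desc_product X k c * desc_product X m d"
  using c
proof (induction c)
  case 0
  then show ?case using assms by (simp add: cong_refl)
next
  case (Suc c)
  let ?x = "X (k - c)" and ?D = "desc_product X m d" and ?E = "desc_product X k c"
  have x: "?x \<in> C" using Suc assms by simp
  have D: "?D \<in> C" and E: "?E \<in> C" using assms Suc by simp_all
  have "?D * desc_product X k (Suc c) = ?D * ?E * ?x" by (simp add: desc_product_Suc mult.assoc)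
  also have "\<dots> \<approx> z ^ (d * c) * ?E * ?D * ?x"
    using Suc x by (intro cong_rmult Suc.IH) simp_all
  also have "\<dots> = z ^ (d * c) * ?E * (?D * ?x)" by (simp add: mult.assoc)
  also have "\<dots> \<approx> z ^ (d * c) * ?E * (z ^ d * ?x * ?D)"
    using Suc assms by (intro cong_lmult desc_product_commute_X) auto
  also have "\<dots> = z ^ (d * c) * (?E * z ^ d) * (?x * ?D)" by (simp add: mult.assoc)
  also have "\<dots> \<approx> z ^ (d * c) * (z ^ d * ?E) * (?x * ?D)"
    using D E x by (intro cong_rmult cong_lmult cong_sym[OF zpow_central]) simp_all
  also have "\<dots> = z ^ (d * Suc c) * desc_product X k (Suc c) * ?D"
    by (simp add: desc_product_Suc mult.assoc power_add add.commute[of d])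
  finally show ?case .
qed

text \<open>Combinations over \<open>k[z]\<close>, modulo \<open>J\<close>, of the standard monomials of parity \<open>\<pi>\<close> (\<open>True\<close> means even) in the
generators below \<open>m\<close>. Generating them inductively rather than by coefficient families makes closure properties a
matter of checking them on a single monomial.\<close>
inductive_set std_span :: "nat \<Rightarrow> bool \<Rightarrow> ('k, 'x) ncpoly set" for m :: nat and \<pi> :: bool where
  std_span_J: "p \<in> J \<Longrightarrow> p \<in> std_span m \<pi>"
| std_span_std_monomial: "s \<in> scalars \<Longrightarrow> (\<And>i. 1 \<le> i \<Longrightarrow> i < m \<Longrightarrow> a i \<le> i) \<Longrightarrow> \<pi> = even (\<Sum>i=1..<m. a i) \<Longrightarrow>
    s * std_monomial X m a \<in> std_span m \<pi>"
| std_span_add: "p \<in> std_span m \<pi> \<Longrightarrow> q \<in> std_span m \<pi> \<Longrightarrow> p + q \<in> std_span m \<pi>"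

lemma std_span_closed: "p \<in> std_span m \<pi> \<Longrightarrow> 1 \<le> m \<Longrightarrow> m \<le> n \<Longrightarrow> p \<in> C"
  by (induction rule: std_span.induct) (simp_all add: J_sub std_monomial_closed scalars_closed)

lemma std_span_cong: "p \<in> std_span m \<pi> \<Longrightarrow> p \<approx> q \<Longrightarrow> q \<in> std_span m \<pi>"
  using std_span_add[OF _ std_span_J, of p m \<pi> "q - p"] cong_sym[of p q] by (simp add: cong_def)

lemma std_span_scalars:
  assumes "p \<in> std_span m \<pi>" and s: "s \<in> scalars" and "1 \<le> m" "m \<le> n"
  shows "s * p \<in> std_span m \<pi>"
  using assms(1)
proof (induction rule: std_span.induct)
  case (std_span_J p)
  then show ?case using J_lmult scalars_closed[OF s] std_span.std_span_J by blast
next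
  case (std_span_std_monomial t a)
  then show ?case using std_span.std_span_std_monomial[OF scalars_mult[OF s std_span_std_monomial(1)], of m a]
    by (simp add: mult.assoc)
next
  case (std_span_add p q)
  then show ?case using std_span.std_span_add by (simp add: distrib_left)
qed

lemma std_span_desc_product:
  assumes "p \<in> std_span m \<pi>" and "1 \<le> m" "Suc m \<le> n" "b \<le> m"
  shows "p * desc_product X m b \<in> std_span (Suc m) (\<pi> = even b)"
  using assms(1)
proof (induction rule: std_span.induct)
  case (std_span_J p)
  then show ?case using J_rmult assms std_span.std_span_J by simp
next
  case (std_span_std_monomial s a)
  let ?a = "a(m := b)"
  have "std_monomial X (Suc m) ?a = std_monomial X m a * desc_product X m b"
    using assms std_monomial_cong[of m ?a a X] by (simp add: std_monomial_Suc)
  moreover have "(\<Sum>i=1..<Suc m. ?a i) = (\<Sum>i=1..<m. a i) + b"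
    using assms by simp
  moreover have "s * std_monomial X (Suc m) ?a \<in> std_span (Suc m) (\<pi> = even b)"
  proof (rule std_span.std_span_std_monomial)
    show "s \<in> scalars" by (rule std_span_std_monomial(1))
    show "?a i \<le> i" if "1 \<le> i" "i < Suc m" for i
      using std_span_std_monomial(2)[of i] that assms by simp
    show "(\<pi> = even b) = even (\<Sum>i=1..<Suc m. ?a i)"
      using std_span_std_monomial(3) \<open>(\<Sum>i=1..<Suc m. ?a i) = _\<close> by simp
  qed
  ultimately show ?case by (simp only: mult.assoc)
next
  case (std_span_add p q)
  then show ?case using std_span.std_span_add by (simp add: distrib_right)
qed

lemma std_span_scalars_desc_product:
  assumes "p \<in> std_span m \<pi>" and "1 \<le> m" "Suc m \<le> n" "b \<le> m" "t \<in> scalars" "\<sigma> = (\<pi> = even b)"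
  shows "p * (t * desc_product X m b) \<in> std_span (Suc m) \<sigma>"
proof -
  have p: "p \<in> C" using std_span_closed assms by simp
  have "t * (p * desc_product X m b) = t * p * desc_product X m b" by (simp add: mult.assoc)
  also have "\<dots> \<approx> p * t * desc_product X m b"
    using assms p by (intro cong_rmult scalars_central) simp_all
  finally show ?thesis
    using std_span_cong[OF std_span_scalars[OF std_span_desc_product[OF assms(1-4)] assms(5)]] assms
      by (simp add: mult.assoc)
qed

lemma std_span_right_desc_product:
  assumes IH: "\<And>p \<pi> j. p \<in> std_span m \<pi> \<Longrightarrow> 1 \<le> j \<Longrightarrow> j < m \<Longrightarrow> p * X j \<in> std_span m (\<not> \<pi>)"
    and p: "p \<in> std_span m \<pi>" and "k < m" "c \<le> k"
  shows "p * desc_product X k c \<in> std_span m (\<pi> = even c)"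
  using \<open>c \<le> k\<close>
proof (induction c)
  case 0
  then show ?case using p by simp
next
  case (Suc c)
  then have "p * desc_product X k c * X (k - c) \<in> std_span m (\<not> (\<pi> = even c))"
    using \<open>k < m\<close> by (intro IH) auto
  then show ?case using Suc by (auto simp: desc_product_Suc mult.assoc)
qed

text \<open>The heart of spanning: moving \<open>X\<^sub>j\<close> through \<open>D = X\<^sub>m X\<^sub>m\<^sub>-\<^sub>1 \<dots>\<close> from the right leaves a combination of
descending products, whose left factors lie in the algebra of the smaller generators. There the induction
hypothesis \<open>IH\<close> applies.\<close>
lemma desc_product_X_step:
  assumes m: "1 \<le> m" "Suc m \<le> n" and b: "b \<le> m" and j: "1 \<le> j" "j \<le> m"
    and IH: "\<And>p \<pi> j. p \<in> std_span m \<pi> \<Longrightarrow> 1 \<le> j \<Longrightarrow> j < m \<Longrightarrow> p * X j \<in> std_span m (\<not> \<pi>)"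
    and u: "u \<in> std_span m \<pi>"
  shows "u * (desc_product X m b * X j) \<in> std_span (Suc m) (\<pi> = odd b)"
proof -
  have uC: "u \<in> C" using u m std_span_closed by simp
  consider "j = m - b" | "j + b = Suc m" | "j + b < m" | "j + b > Suc m" by linarith
  then show ?thesis
  proof cases
    case 1
    \<comment> \<open>\<open>X\<^sub>j\<close> prolongs the descending product.\<close>
    then have "desc_product X m b * X j = desc_product X m (Suc b)" by (simp add: desc_product_Suc)
    then show ?thesis using std_span_desc_product[OF u m, of "Suc b"] 1 j by simp
  next
    case 2
    \<comment> \<open>\<open>X\<^sub>j\<close> meets itself, and the quadratic relation removes both.\<close>
    then obtain b' where b': "b = Suc b'" using j by (cases b) auto
    let ?D = "desc_product X m b'"
    have D: "?D \<in> C" using b b' m by simp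
    have j': "m - b' = j" using 2 b' by simp
    have t: "scal \<theta> * z + 1 \<in> scalars"
      using scalars_add[OF scalars_mult[OF scalars_scal scalars_z] scalars_scal[of 1]] by (simp add: scal_1)
    have "(scal \<theta> * z + 1) * ?D \<approx> ?D * (scal \<theta> * z + 1)"
      by (rule scalars_central[OF t D])
    also have "\<dots> \<approx> ?D * (X j * X j)"
      using X_square[of j] j m D by (intro cong_lmult cong_sym[of "X j * X j"]) (simp_all add: cong_def)
    also have "\<dots> = desc_product X m b * X j"
      using b' j' by (simp add: desc_product_Suc mult.assoc)
    finally have "u * ((scal \<theta> * z + 1) * ?D) \<approx> u * (desc_product X m b * X j)"
      by (rule cong_lmult[OF _ uC])
    moreover have "u * ((scal \<theta> * z + 1) * ?D) \<in> std_span (Suc m) (\<pi> = odd b)"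
      using b b' by (intro std_span_scalars_desc_product[OF u m _ t]) auto
    ultimately show ?thesis by (rule std_span_cong[rotated])
  next
    case 3
    \<comment> \<open>\<open>X\<^sub>j\<close> is far from every factor and passes to the left at the price of \<open>z\<^sup>b\<close>.\<close>
    have "desc_product X m b * X j \<approx> z ^ b * X j * desc_product X m b"
      using m b j 3 by (intro desc_product_commute_X) auto
    also have "\<dots> \<approx> X j * z ^ b * desc_product X m b"
      using m b j by (intro cong_rmult zpow_central) auto
    finally have "u * (X j * z ^ b * desc_product X m b) \<approx> u * (desc_product X m b * X j)"
      by (rule cong_lmult[OF cong_sym uC])
    moreover have "u * X j * (z ^ b * desc_product X m b) \<in> std_span (Suc m) (\<pi> = odd b)"
      using j 3 m b by (intro std_span_scalars_desc_product[OF IH[OF u, of j] m] scalars_zpow) auto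
    then have "u * (X j * z ^ b * desc_product X m b) \<in> std_span (Suc m) (\<pi> = odd b)"
      by (simp only: mult.assoc)
    ultimately show ?thesis by (rule std_span_cong[rotated])
  next
    case 4
    \<comment> \<open>Both \<open>X\<^sub>j\<close> and \<open>X\<^sub>j\<^sub>-\<^sub>1\<close> occur: \<open>D = X\<^sub>m \<dots> X\<^sub>j\<^sub>+\<^sub>1 \<cdot> X\<^sub>j X\<^sub>j\<^sub>-\<^sub>1 \<cdot> X\<^sub>j\<^sub>-\<^sub>2 \<dots>\<close>, with \<open>d\<close> factors before and \<open>c\<close> factors
      after the pair. Once \<open>X\<^sub>j\<close> has passed the last group, the braid relation in the middle gives three terms, and in
      each of them the letters below \<open>X\<^sub>j\<close> that stand next to the first group, prolonged by \<open>X\<^sub>j\<close> in the last term,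
      pass it.\<close>
    define d where "d = m - j"
    define k where "k = j - 2"
    define c where "c = b - d - 2"
    have jk: "j = Suc (Suc k)" and mj: "m = Suc (Suc k) + d" and bc: "b = d + Suc (Suc c)" and ck: "c \<le> k"
      using 4 j b by (auto simp: d_def k_def c_def)
    let ?D = "desc_product X m d" and ?E = "desc_product X k c" and ?x = "X (Suc k)" and ?y = "X j"
    have C: "?D \<in> C" "?E \<in> C" "?x \<in> C" "?y \<in> C"
      using m j jk mj ck by simp_all
    have D_b: "desc_product X m b = ?D * (?y * ?x * ?E)"
      unfolding bc desc_product_add using mj jk by (simp add: desc_product_Suc_left mult.assoc)
    have E_x: "desc_product X (Suc k) (Suc c) = ?x * ?E" by (simp add: desc_product_Suc_left)
    have D_y: "desc_product X m (Suc d) = ?D * ?y" using mj jk by (simp add: desc_product_Suc)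
    have "desc_product X m b * X j = ?D * ?y * ?x * (?E * X j)" by (simp add: D_b mult.assoc)
    also have "\<dots> \<approx> ?D * ?y * ?x * (z ^ c * X j * ?E)"
      using C m j jk mj ck by (intro cong_lmult desc_product_commute_X) auto
    also have "\<dots> = (?D * ?y * ?x) * z ^ c * (X j * ?E)" by (simp add: mult.assoc)
    also have "\<dots> \<approx> z ^ c * (?D * ?y * ?x) * (X j * ?E)"
      using C by (intro cong_rmult cong_sym[OF zpow_central]) simp_all
    also have "\<dots> = z ^ c * ?D * (?y * ?x * ?y) * ?E" by (simp add: mult.assoc)
    also have "\<dots> \<approx> z ^ c * ?D * (?x * ?y * ?x - scal \<eta> * (?y - ?x)) * ?E"
    proof (intro cong_rmult cong_lmult)
      have "?x * ?y * ?x - ?y * ?x * ?y - scal \<eta> * (?y - ?x) \<in> J"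
        using X_braid[of "Suc k"] m mj jk by simp
      from J_uminus[OF this] show "?y * ?x * ?y \<approx> ?x * ?y * ?x - scal \<eta> * (?y - ?x)"
        using C by (simp add: cong_def algebra_simps)
    qed (use C in simp_all)
    also have "\<dots> = z ^ c * (?D * ?x) * (?y * ?x * ?E)
        + (z ^ c * scal \<eta>) * (?D * desc_product X (Suc k) (Suc c))
        + (z ^ c * scal (- \<eta>)) * (desc_product X m (Suc d) * ?E)"
    proof -
      have "?D * (scal \<eta> * w) = scal \<eta> * (?D * w)" for w
        by (simp only: mult.assoc[symmetric] scal_commute[of \<eta> ?D])
      then show ?thesis
        by (simp add: E_x D_y scal_uminus algebra_simps)
    qed
    also have "\<dots> \<approx> z ^ c * (z ^ d * ?x * ?D) * (?y * ?x * ?E)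
        + (z ^ c * scal \<eta>) * (z ^ (d * Suc c) * desc_product X (Suc k) (Suc c) * ?D)
        + (z ^ c * scal (- \<eta>)) * (z ^ (Suc d * c) * ?E * desc_product X m (Suc d))"
      using C m mj jk ck
      by (intro cong_add cong_rmult[OF cong_lmult] cong_lmult desc_product_commute_X desc_product_commute_desc_product) auto
    also have "\<dots> = (z ^ c * z ^ d) * ?x * desc_product X m b
        + (z ^ c * scal \<eta> * z ^ (d * Suc c)) * desc_product X (Suc k) (Suc c) * ?D
        + (z ^ c * scal (- \<eta>) * z ^ (Suc d * c)) * ?E * desc_product X m (Suc d)"
      by (simp add: D_b mult.assoc)
    also have "\<dots> \<approx> ?x * (z ^ c * z ^ d) * desc_product X m b
        + desc_product X (Suc k) (Suc c) * (z ^ c * scal \<eta> * z ^ (d * Suc c)) * ?D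
        + ?E * (z ^ c * scal (- \<eta>) * z ^ (Suc d * c)) * desc_product X m (Suc d)"
      using C m mj jk ck b
      by (intro cong_add cong_rmult scalars_central scalars_mult scalars_zpow scalars_scal) auto
    finally have "u * (?x * (z ^ c * z ^ d) * desc_product X m b
        + desc_product X (Suc k) (Suc c) * (z ^ c * scal \<eta> * z ^ (d * Suc c)) * ?D
        + ?E * (z ^ c * scal (- \<eta>) * z ^ (Suc d * c)) * desc_product X m (Suc d)) \<approx> u * (desc_product X m b * X j)"
      by (rule cong_lmult[OF cong_sym uC])
    moreover have "u * (?x * (z ^ c * z ^ d) * desc_product X m b
        + desc_product X (Suc k) (Suc c) * (z ^ c * scal \<eta> * z ^ (d * Suc c)) * ?D
        + ?E * (z ^ c * scal (- \<eta>) * z ^ (Suc d * c)) * desc_product X m (Suc d)) \<in> std_span (Suc m) (\<pi> = odd b)"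
    proof -
      have ux: "u * ?x \<in> std_span m (\<not> \<pi>)"
        using mj by (intro IH[OF u]) simp_all
      have uEx: "u * desc_product X (Suc k) (Suc c) \<in> std_span m (\<pi> = even (Suc c))"
        by (rule std_span_right_desc_product[OF _ u], erule (2) IH) (use mj ck in simp_all)
      have uE: "u * ?E \<in> std_span m (\<pi> = even c)"
        by (rule std_span_right_desc_product[OF _ u], erule (2) IH) (use mj ck in simp_all)
      have "u * ?x * ((z ^ c * z ^ d) * desc_product X m b) \<in> std_span (Suc m) (\<pi> = odd b)"
        by (rule std_span_scalars_desc_product[OF ux m b scalars_mult[OF scalars_zpow scalars_zpow]]) auto
      moreover have "u * desc_product X (Suc k) (Suc c) * ((z ^ c * scal \<eta> * z ^ (d * Suc c)) * ?D)
          \<in> std_span (Suc m) (\<pi> = odd b)"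
        by (rule std_span_scalars_desc_product[OF uEx m _ scalars_mult[OF scalars_mult[OF scalars_zpow scalars_scal] scalars_zpow]]) (auto simp: mj bc)
      moreover have "u * ?E * ((z ^ c * scal (- \<eta>) * z ^ (Suc d * c)) * desc_product X m (Suc d))
          \<in> std_span (Suc m) (\<pi> = odd b)"
        by (rule std_span_scalars_desc_product[OF uE m _ scalars_mult[OF scalars_mult[OF scalars_zpow scalars_scal] scalars_zpow]]) (auto simp: mj bc)
      ultimately show ?thesis
        unfolding distrib_left by (intro std_span.std_span_add) (simp_all only: mult.assoc)
    qed
    ultimately show ?thesis by (rule std_span_cong[rotated])
  qed
qed

lemma std_span_X:
  assumes "p \<in> std_span m \<pi>" "1 \<le> j" "j < m" "m \<le> n"
  shows "p * X j \<in> std_span m (\<not> \<pi>)"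
  using assms
proof (induction m arbitrary: p \<pi> j)
  case (Suc m)
  have IH: "p * X j \<in> std_span m (\<not> \<pi>)" if "p \<in> std_span m \<pi>" "1 \<le> j" "j < m" for p \<pi> j
    using Suc.IH that Suc.prems by simp
  have m: "1 \<le> m" "Suc m \<le> n" using Suc.prems by auto
  from Suc.prems(1) show ?case
  proof (induction rule: std_span.induct)
    case (std_span_J p)
    then show ?case using J_rmult Suc.prems std_span.std_span_J by simp
  next
    case (std_span_std_monomial s a)
    have "s * std_monomial X m a * (desc_product X m (a m) * X j) \<in> std_span (Suc m) (even (\<Sum>i=1..<m. a i) = odd (a m))"
    proof (rule desc_product_X_step[OF m])
      show "a m \<le> m" using std_span_std_monomial(2)[of m] m by simp
      show "1 \<le> j" "j \<le> m" using Suc.prems by simp_all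
      show "p * X j \<in> std_span m (\<not> \<pi>)" if "p \<in> std_span m \<pi>" "1 \<le> j" "j < m" for p \<pi> j
        using that by (rule IH)
      show "s * std_monomial X m a \<in> std_span m (even (\<Sum>i=1..<m. a i))"
        using std_span_std_monomial(1,2) by (intro std_span.std_span_std_monomial) simp_all
    qed
    moreover have "(even (\<Sum>i=1..<m. a i) = odd (a m)) = (\<not> \<pi>)"
      using std_span_std_monomial m by auto
    ultimately show ?case
      using m by (simp add: std_monomial_Suc mult.assoc)
  next
    case (std_span_add p q)
    then show ?case using std_span.std_span_add by (simp add: distrib_right)
  qed
qed simp

lemma std_span_scal: "1 \<le> n \<Longrightarrow> scal c \<in> std_span n True"
proof -
  assume "1 \<le> n"
  then have "std_monomial X n (\<lambda>_. 0) = 1"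
    by (induction n rule: dec_induct) (simp_all add: std_monomial_Suc)
  then show ?thesis using std_span_std_monomial[OF scalars_scal, of n "\<lambda>_. 0" True c] by simp
qed

lemma std_span_z: "p \<in> std_span n \<pi> \<Longrightarrow> 1 \<le> n \<Longrightarrow> p * z \<in> std_span n \<pi>"
  by (rule std_span_cong[OF std_span_scalars[OF _ scalars_z] scalars_central[OF scalars_z]]) (simp_all add: std_span_closed[of p n \<pi>])

lemma std_span_spanned:
  fixes F :: "(nat \<Rightarrow> nat) \<times> bool \<Rightarrow> ('k, 'x) ncpoly"
  defines "F \<equiv> \<lambda>(a, b). if b then z * std_monomial X n a else std_monomial X n a"
  assumes "p \<in> std_span n True" "1 \<le> n"
  shows "\<exists>c. p - (\<Sum>i\<in>even_exps n \<times> UNIV. scal (c i) * F i) \<in> J"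
    (is "\<exists>c. p - ?S c \<in> J")
  using assms(2)
proof (induction rule: std_span.induct)
  case (std_span_J p)
  have "?S (\<lambda>_. 0) = 0" by (simp add: scal_0)
  then show ?case using std_span_J by (intro exI[of _ "\<lambda>_. 0"]) simp
next
  case (std_span_std_monomial s a)
  obtain x y where s: "s \<approx> scal x + scal y * z" using std_span_std_monomial(1) unfolding scalars_def by blast
  define a' where "a' = restrict a {1..n-1}"
  have rng: "{Suc 0..n - Suc 0} = {Suc 0..<n}" using assms(3) by auto
  have a': "a' \<in> even_exps n"
    using std_span_std_monomial(2,3) by (auto simp: a'_def even_exps_def rng)
  have std_monomial: "std_monomial X n a' = std_monomial X n a" by (intro std_monomial_cong) (auto simp: a'_def)
  have C: "std_monomial X n a \<in> C" using std_span_std_monomial(2) assms(3)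
    by (intro std_monomial_closed) auto
  define c where "c i = (if i = (a', False) then x else if i = (a', True) then y else 0)" for i
  have "?S c = (\<Sum>i\<in>{(a', False), (a', True)}. scal (c i) * F i)"
  proof (rule sum.mono_neutral_right)
    show "\<forall>i\<in>even_exps n \<times> UNIV - {(a', False), (a', True)}. scal (c i) * F i = 0"
      by (simp add: c_def scal_0)
  qed (use a' finite_even_exps in simp_all)
  also have "\<dots> = (scal x + scal y * z) * std_monomial X n a"
    by (simp add: c_def F_def std_monomial distrib_right mult.assoc)
  finally have "s * std_monomial X n a - ?S c = (s - (scal x + scal y * z)) * std_monomial X n a"
    by (simp add: left_diff_distrib)
  also have "\<dots> \<in> J" using s by (intro J_rmult C) (simp add: cong_def)
  finally show ?case by (intro exI[of _ c])
next
  case (std_span_add p q)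
  then obtain c d where cd: "p - ?S c \<in> J" "q - ?S d \<in> J" by blast
  have "?S (\<lambda>i. c i + d i) = ?S c + ?S d"
    by (simp only: scal_add distrib_right sum.distrib)
  then have "p + q - ?S (\<lambda>i. c i + d i) = (p - ?S c) + (q - ?S d)" by simp
  also have "\<dots> \<in> J" by (rule J_add[OF cd])
  finally show ?case by (intro exI[of _ "\<lambda>i. c i + d i"])
qed

end

section \<open>The ring of additive endomorphisms\<close>

text \<open>Operators form a ring type, so that the defining relations can be checked by the simplifier for
noncommutative rings. The class \<open>ring_1\<close> of the underlying type guarantees \<open>0 \<noteq> 1\<close> for operators.\<close>
typedef (overloaded) 'v endo = "{F :: 'v::ring_1 \<Rightarrow> 'v. \<forall>x y. F (x + y) = F x + F y}"
  morphisms app Endo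
  by (rule exI[of _ id]) simp

setup_lifting type_definition_endo

instantiation endo :: (ring_1) ring_1
begin

lift_definition zero_endo :: "'a endo" is "\<lambda>_. 0" by simp
lift_definition one_endo :: "'a endo" is "\<lambda>x. x" by simp
lift_definition plus_endo :: "'a endo \<Rightarrow> 'a endo \<Rightarrow> 'a endo" is "\<lambda>F G x. F x + G x"
  by (simp add: algebra_simps)
lift_definition minus_endo :: "'a endo \<Rightarrow> 'a endo \<Rightarrow> 'a endo" is "\<lambda>F G x. F x - G x"
  by (simp add: algebra_simps)
lift_definition uminus_endo :: "'a endo \<Rightarrow> 'a endo" is "\<lambda>F x. - F x"
  by simp
lift_definition times_endo :: "'a endo \<Rightarrow> 'a endo \<Rightarrow> 'a endo" is "\<lambda>F G x. F (G x)"
  by simp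

instance
proof
  fix a b c :: "'a endo"
  show "a * b * c = a * (b * c)" "1 * a = a" "a * 1 = a" "a + b + c = a + (b + c)"
    "a + b = b + a" "0 + a = a" "- a + a = 0" "a - b = a + - b"
    "(a + b) * c = a * c + b * c"
    by (transfer; simp add: algebra_simps)+
  show "a * (b + c) = a * b + a * c"
    by transfer simp
  show "(0 :: 'a endo) \<noteq> 1"
    by transfer (auto simp: fun_eq_iff intro!: exI[of _ 1])
qed

end

lemma app_simps [simp]:
  "app 0 v = 0" "app 1 v = v" "app (F + G) v = app F v + app G v" "app (F - G) v = app F v - app G v"
  "app (- F) v = - app F v" "app (F * G) v = app F (app G v)" "app F (v + w) = app F v + app F w"
  by (transfer; simp)+

lemma app_zero [simp]: "app F 0 = 0"
  using app_simps(7)[of F 0 0] by simp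

lemma endo_eqI: "(\<And>v. app F v = app G v) \<Longrightarrow> F = G"
  by (metis app_inject ext)

section \<open>The Clifford algebra on spinors\<close>

text \<open>Functions of sets of numbers carry a representation of the Clifford algebra with one generator for every number. A vector of the whole
representation assigns a spinor to every word, and \<open>f i\<close> is the letter that the word \<open>f\<close> has in place \<open>i\<close>.\<close>
type_synonym 'k spinor = "nat set \<Rightarrow> 'k"
type_synonym 'k wordspinor = "(nat \<Rightarrow> nat) \<Rightarrow> 'k spinor"

lift_definition fibrewise :: "'k::field spinor endo \<Rightarrow> 'k wordspinor endo"
  is "\<lambda>F \<phi> f. F (\<phi> f)"
  by (simp add: fun_eq_iff)

lemma app_fibrewise: "app (fibrewise F) \<phi> f = app F (\<phi> f)"
  by transfer simp

lemma fibrewise_hom: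
  "fibrewise 1 = 1" "fibrewise 0 = 0" "fibrewise (F + G) = fibrewise F + fibrewise G"
  "fibrewise (F * G) = fibrewise F * fibrewise G" "fibrewise (- F) = - fibrewise F"
  "fibrewise (F - G) = fibrewise F - fibrewise G"
  by (transfer; simp add: fun_eq_iff)+

lift_definition scalar :: "'k::field \<Rightarrow> 'k spinor endo" is "\<lambda>c v S. c * v S"
  by (simp add: fun_eq_iff distrib_left)

lemma app_scalar: "app (scalar c) v S = c * v S"
  by transfer simp

lemma scalar_hom:
  "scalar 1 = 1" "scalar 0 = 0" "scalar (c + d) = scalar c + scalar d" "scalar (c * d) = scalar c * scalar d"
  "scalar (- c) = - scalar c" "scalar (c - d) = scalar c - scalar d"
  by (transfer; simp add: fun_eq_iff algebra_simps)+

text \<open>The Jordan-Wigner construction: \<open>c\<^sub>i\<close> flips membership of \<open>i\<close>, with a sign that counts the elements up to \<open>i\<close>.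
That \<open>i\<close> itself is counted makes the square \<open>-1\<close>.\<close>
definition flip :: "nat \<Rightarrow> nat set \<Rightarrow> nat set" where
  "flip i S = (if i \<in> S then S - {i} else insert i S)"

definition sgn_upto :: "nat \<Rightarrow> nat set \<Rightarrow> 'k::field" where
  "sgn_upto i S = (- 1) ^ card (S \<inter> {..i})"

lift_definition clifford :: "nat \<Rightarrow> 'k::field spinor endo"
  is "\<lambda>i v S. sgn_upto i S * v (flip i S)"
  by (simp add: fun_eq_iff distrib_left)

lemma app_clifford: "app (clifford i) v S = sgn_upto i S * v (flip i S)"
  by transfer simp

lemma clifford_scalar: "clifford i * scalar c = scalar c * clifford i"
  by (transfer; simp add: fun_eq_iff)

lemma flip_flip [simp]: "flip i (flip i S) = S"
  by (auto simp: flip_def)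

lemma flip_commute: "flip i (flip j S) = flip j (flip i S)"
  by (auto simp: flip_def)

lemma sgn_upto_flip: "sgn_upto j (flip i S) = (if i \<le> j then - sgn_upto j S else sgn_upto j S)"
proof (cases "i \<in> S")
  case True
  have "card (S \<inter> {..j}) = Suc (card ((S - {i}) \<inter> {..j}))" if "i \<le> j"
  proof -
    have "S \<inter> {..j} = insert i ((S - {i}) \<inter> {..j})" using True that by auto
    then show ?thesis by simp
  qed
  moreover have "(S - {i}) \<inter> {..j} = S \<inter> {..j}" if "\<not> i \<le> j" using that by auto
  ultimately show ?thesis using True by (simp add: sgn_upto_def flip_def)
next
  case False
  then show ?thesis by (simp add: sgn_upto_def flip_def)
qed

lemma sgn_upto_square: "sgn_upto i S * sgn_upto i S = 1"
  by (simp add: sgn_upto_def flip: power_add mult_2)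

lemma clifford_square: "clifford i * clifford i = (- 1 :: 'k::field spinor endo)"
proof (rule endo_eqI, rule ext)
  fix v :: "'k spinor" and S
  have "app (clifford i * clifford i) v S = - (sgn_upto i S * sgn_upto i S * v S)"
    by (simp add: app_clifford sgn_upto_flip)
  then show "app (clifford i * clifford i) v S = app (- 1) v S"
    by (simp add: sgn_upto_square)
qed

lemma clifford_anticommute:
  assumes "i \<noteq> j"
  shows "clifford i * clifford j = - (clifford j * clifford i :: 'k::field spinor endo)"
proof (rule endo_eqI, rule ext)
  fix v :: "'k spinor" and S
  show "app (clifford i * clifford j) v S = app (- (clifford j * clifford i)) v S"
    using assms by (auto simp: app_clifford sgn_upto_flip flip_commute[of i j])
qed

section \<open>The Hecke algebra on words\<close>

definition swap_at :: "nat \<Rightarrow> (nat \<Rightarrow> nat) \<Rightarrow> nat \<Rightarrow> nat" where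
  "swap_at i f = f(i := f (Suc i), Suc i := f i)"

text \<open>The action on tensor space by quantum permutation of the letters \<open>f i\<close> and \<open>f (i + 1)\<close>, seen on coordinate
functions. The value \<open>q\<close> for equal letters is one of the two roots of \<open>x\<^sup>2 = (q - q\<^sup>-\<^sup>1) x + 1\<close>, as the quadratic
relation requires.\<close>
lift_definition hecke :: "'k::field \<Rightarrow> nat \<Rightarrow> 'k wordspinor endo"
  is "\<lambda>q i \<phi> f. if f i < f (Suc i) then \<phi> (swap_at i f)
      else if f i = f (Suc i) then (\<lambda>S. q * \<phi> f S)
      else \<phi> (swap_at i f) + (\<lambda>S. (q - inverse q) * \<phi> f S)"
  by (auto simp: fun_eq_iff algebra_simps)

lemma app_hecke: "app (hecke q i) \<phi> f = (if f i < f (Suc i) then \<phi> (swap_at i f)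
      else if f i = f (Suc i) then app (scalar q) (\<phi> f)
      else \<phi> (swap_at i f) + app (scalar (q - inverse q)) (\<phi> f))"
  by (transfer; simp)

lemma swap_at_simps [simp]: "swap_at i f i = f (Suc i)" "swap_at i f (Suc i) = f i"
  "k \<noteq> i \<Longrightarrow> k \<noteq> Suc i \<Longrightarrow> swap_at i f k = f k"
  by (simp_all add: swap_at_def)

lemma swap_at_involution [simp]: "swap_at i (swap_at i f) = f"
  by (auto simp: swap_at_def fun_eq_iff)

lemma fibrewise_hecke:
  assumes "\<And>c. F * scalar c = scalar c * F"
  shows "fibrewise F * hecke q i = hecke q i * fibrewise F"
proof (rule endo_eqI, rule ext)
  fix \<phi> :: "'a wordspinor" and f
  have "app F (app (scalar c) v) = app (scalar c) (app F v)" for c v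
    using assms[of c] by (metis app_simps(6))
  then show "app (fibrewise F * hecke q i) \<phi> f = app (hecke q i * fibrewise F) \<phi> f"
    by (simp add: app_hecke app_fibrewise)
qed

lemma hecke_square:
  assumes "q \<noteq> 0"
  shows "hecke q i * hecke q i = fibrewise (scalar (q - inverse q)) * hecke q i + 1"
proof (rule endo_eqI, intro ext)
  fix \<phi> :: "'a wordspinor" and f S
  show "app (hecke q i * hecke q i) \<phi> f S = app (fibrewise (scalar (q - inverse q)) * hecke q i + 1) \<phi> f S"
    using assms by (simp add: app_hecke app_fibrewise app_scalar algebra_simps)
qed

lemma hecke_commute:
  assumes "Suc i < j"
  shows "hecke q i * hecke q j = hecke q j * hecke q i"
proof (rule endo_eqI, intro ext)
  fix \<phi> :: "'a wordspinor" and f S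
  have sw: "swap_at i (swap_at j f) = swap_at j (swap_at i f)"
    using assms by (auto simp: swap_at_def fun_eq_iff)
  have "swap_at j f i = f i" "swap_at j f (Suc i) = f (Suc i)"
    "swap_at i f j = f j" "swap_at i f (Suc j) = f (Suc j)"
    using assms by simp_all
  then show "app (hecke q i * hecke q j) \<phi> f S = app (hecke q j * hecke q i) \<phi> f S"
    by (simp add: app_hecke app_fibrewise app_scalar sw algebra_simps)
qed

text \<open>Only the letters in three adjacent places matter, and the orders in which they can stand are finite in
number.\<close>
lemma hecke_braid:
  assumes "q \<noteq> 0"
  shows "hecke q i * hecke q (Suc i) * hecke q i = hecke q (Suc i) * hecke q i * hecke q (Suc i)"
proof (rule endo_eqI, intro ext)
  fix \<phi> :: "'a wordspinor" and f :: "nat \<Rightarrow> nat" and S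
  define W where "W a b c = f(i := a, Suc i := b, Suc (Suc i) := c)" for a b c
  have W: "W a b c i = a" "W a b c (Suc i) = b" "W a b c (Suc (Suc i)) = c"
    "swap_at i (W a b c) = W b a c" "swap_at (Suc i) (W a b c) = W a c b" for a b c
    by (auto simp: W_def swap_at_def fun_eq_iff)
  define a b c where "a = f i" "b = f (Suc i)" "c = f (Suc (Suc i))"
  have f: "f = W a b c"
    by (simp add: W_def a_b_c_def)
  have cancel: "q * (inverse q * x) = x" for x
    using assms by (simp add: mult.assoc[symmetric])
  show "app (hecke q i * hecke q (Suc i) * hecke q i) \<phi> f S =
        app (hecke q (Suc i) * hecke q i * hecke q (Suc i)) \<phi> f S"
    unfolding f using assms
    by (cases a b rule: linorder_cases; cases b c rule: linorder_cases; cases a c rule: linorder_cases;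
       simp add: app_hecke W app_scalar cancel algebra_simps)
qed

section \<open>Clifford-twisted Hecke operators\<close>

lemma commute_assoc: "x * y = y * x \<Longrightarrow> x * (y * w) = y * (x * w)" for x y w :: "'r::ring_1"
  by (metis mult.assoc)

text \<open>The relations for \<open>a T + e g\<close> follow formally: products of the coefficients \<open>a\<close>, \<open>g\<close> commute with products of the
Hecke generators and with the central \<open>e\<close>, so each relation splits into identities among the coefficients, one for
every power of \<open>e\<close> and every Hecke monomial.\<close>
lemma twisted_square:
  fixes a g e T z :: "'r::ring_1"
  assumes comm: "T * a = a * T" "T * g = g * T" "a * e = e * a" "g * e = e * g" "T * e = e * T"
    and T: "T * T = e * T + 1"
    and ag: "a * a = 3 * z + 1" "g * g = z" "a * g + g * a = - (a * a)"
  shows "(a * T + e * g) * (a * T + e * g) = (e * e + 3) * z + 1"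
proof -
  have "(a * T + e * g) * (a * T + e * g) = a * a * (T * T) + e * (a * g + g * a) * T + e * e * (g * g)"
    by (simp add: algebra_simps comm comm[THEN commute_assoc])
  also have "\<dots> = a * a * (e * T + 1) - e * (a * a) * T + e * e * z"
    by (simp only: T ag(2,3)) (simp add: algebra_simps)
  also have "\<dots> = a * a + e * e * z"
    by (simp add: algebra_simps comm comm[THEN commute_assoc])
  finally show ?thesis by (simp only: ag(1)) (simp add: algebra_simps)
qed

lemma twisted_commute:
  fixes a b g h e S T z :: "'r::ring_1"
  assumes comm: "S * b = b * S" "S * h = h * S" "T * a = a * T" "T * g = g * T" "T * S = S * T"
      "a * e = e * a" "b * e = e * b" "g * e = e * g" "h * e = e * h" "S * e = e * S" "T * e = e * T" "z * e = e * z"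
    and tw: "a * b = z * b * a" "a * h = z * h * a" "g * b = z * b * g" "g * h = z * h * g"
  shows "(a * S + e * g) * (b * T + e * h) = z * (b * T + e * h) * (a * S + e * g)"
proof -
  have tw': "a * (b * w) = z * (b * (a * w))" "a * (h * w) = z * (h * (a * w))"
    "g * (b * w) = z * (b * (g * w))" "g * (h * w) = z * (h * (g * w))" for w
    using tw by (metis mult.assoc)+
  show ?thesis
    by (simp add: algebra_simps comm comm[THEN commute_assoc] tw tw')
qed

text \<open>Expand in powers of \<open>e\<close>. The cubic terms in \<open>S\<close> and \<open>T\<close> cancel by \<open>r1\<close> and the braid relation, the quadratic
ones by \<open>r2\<close>, \<open>r3\<close> and \<open>r4\<close> up to the linear terms that \<open>S\<^sup>2 = e S + 1\<close> leaves behind; \<open>r5\<close> and \<open>r6\<close> collect the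
coefficients of \<open>S\<close> and \<open>T\<close>, and \<open>r7\<close> the constant term.\<close>
lemma twisted_braid:
  fixes a b g h e S T :: "'r::ring_1"
  assumes comm: "S * a = a * S" "S * b = b * S" "S * g = g * S" "S * h = h * S"
      "T * a = a * T" "T * b = b * T" "T * g = g * T" "T * h = h * T"
      "a * e = e * a" "b * e = e * b" "g * e = e * g" "h * e = e * h" "S * e = e * S" "T * e = e * T"
    and hecke: "S * S = e * S + 1" "T * T = e * T + 1" "S * T * S = T * S * T"
    and r1: "a * b * a = b * a * b" and r2: "a * b * g = h * a * b" and r3: "g * b * a = b * a * h"
    and r4: "a * h * a = b * g * b"
    and r5: "a * h * a + a * h * g + g * h * a - h * a * h = - a"
    and r6: "g * b * g - b * g * b - b * g * h - h * g * b = b"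
    and r7: "g * h * g - h * g * h = h - g"
  shows "(a * S + e * g) * (b * T + e * h) * (a * S + e * g) -
      (b * T + e * h) * (a * S + e * g) * (b * T + e * h) = e * e * ((b * T + e * h) - (a * S + e * g))"
proof -
  have "(a * S + e * g) * (b * T + e * h) * (a * S + e * g) -
      (b * T + e * h) * (a * S + e * g) * (b * T + e * h) =
      (a * b * a) * (S * T * S) - (b * a * b) * (T * S * T)
      + e * ((a * b * g - h * a * b) * (S * T) + (g * b * a - b * a * h) * (T * S)
          + (a * h * a) * (S * S) - (b * g * b) * (T * T))
      + e * e * ((a * h * g + g * h * a - h * a * h) * S + (g * b * g - b * g * h - h * g * b) * T)
      + e * e * e * (g * h * g - h * g * h)"
    by (simp add: algebra_simps comm comm[THEN commute_assoc])
  also have "\<dots> = e * ((a * h * a) * (e * S + 1) - (a * h * a) * (e * T + 1))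
      + e * e * ((- a - a * h * a) * S + (b + a * h * a) * T) + e * e * e * (h - g)"
  proof -
    have "a * h * g + g * h * a - h * a * h = - a - a * h * a"
      using r5 by (simp add: algebra_simps)
    moreover have "g * b * g - b * g * h - h * g * b = b + a * h * a"
      using r6 unfolding r4 by (simp add: algebra_simps)
    ultimately show ?thesis
      by (simp only: hecke r1 r2 r3 r4[symmetric] r7) simp
  qed
  also have "\<dots> = e * e * ((b * T + e * h) - (a * S + e * g))"
    by (simp add: algebra_simps comm comm[THEN commute_assoc])
  finally show ?thesis .
qed

text \<open>The coefficients \<open>a\<close> and \<open>g\<close> for \<open>z = -1\<close> (\<open>s = True\<close>, Clifford elements) and for \<open>z = 1\<close> (\<open>s = False\<close>,
scalars).\<close>
definition hecke_coef :: "bool \<Rightarrow> nat \<Rightarrow> 'k::field spinor endo" where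
  "hecke_coef s i = (if s then clifford i - clifford (Suc i) else 2)"

definition const_coef :: "bool \<Rightarrow> nat \<Rightarrow> 'k::field spinor endo" where
  "const_coef s i = (if s then clifford (Suc i) else - 1)"

definition zsign :: "bool \<Rightarrow> 'r::ring_1" where
  "zsign s = (if s then - 1 else 1)"

definition twisted_hecke :: "'k::field \<Rightarrow> bool \<Rightarrow> nat \<Rightarrow> 'k wordspinor endo" where
  "twisted_hecke q s i = fibrewise (hecke_coef s i) * hecke q i + fibrewise (scalar (q - inverse q)) * fibrewise (const_coef s i)"

lemma clifford_rules:
  fixes x :: "'k::field spinor endo"
  assumes "i < j"
  shows "clifford j * clifford i = - (clifford i * clifford j :: 'k spinor endo)"
    "clifford j * (clifford i * x) = - (clifford i * (clifford j * x))"
proof -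
  show *: "clifford j * clifford i = - (clifford i * clifford j :: 'k spinor endo)"
    using assms by (intro clifford_anticommute) simp
  have "clifford j * (clifford i * x) = (clifford j * clifford i) * x" by (simp only: mult.assoc)
  also have "\<dots> = - (clifford i * (clifford j * x))" unfolding * by (simp add: mult.assoc)
  finally show "clifford j * (clifford i * x) = - (clifford i * (clifford j * x))" .
qed

lemma clifford_square_assoc: "clifford i * (clifford i * x) = - x" for x :: "'k::field spinor endo"
proof -
  have "clifford i * (clifford i * x) = (clifford i * clifford i) * x" by (simp only: mult.assoc)
  then show ?thesis by (simp add: clifford_square)
qed

lemma coef_relations:
  fixes i :: nat and s :: bool
  defines "a \<equiv> hecke_coef s i :: 'k::field spinor endo" and "b \<equiv> hecke_coef s (Suc i)" and "g \<equiv> const_coef s i" and "h \<equiv> const_coef s (Suc i)"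
  shows "a * a = 3 * zsign s + 1" "g * g = zsign s" "a * g + g * a = - (a * a)"
    "a * b * a = b * a * b" "a * b * g = h * a * b" "g * b * a = b * a * h" "a * h * a = b * g * b"
    "a * h * a + a * h * g + g * h * a - h * a * h = - a"
    "g * b * g - b * g * b - b * g * h - h * g * b = b"
    "g * h * g - h * g * h = h - g"
  unfolding a_def b_def g_def h_def hecke_coef_def const_coef_def zsign_def
  by (cases s; simp add: algebra_simps clifford_rules clifford_square clifford_square_assoc)+

lemma coef_twisted_commute:
  fixes i j :: nat and s :: bool
  assumes "\<bar>int i - int j\<bar> > 1"
  shows "hecke_coef s i * hecke_coef s j = (zsign s * hecke_coef s j * hecke_coef s i :: 'k::field spinor endo)"
    "hecke_coef s i * const_coef s j = (zsign s * const_coef s j * hecke_coef s i :: 'k::field spinor endo)"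
    "const_coef s i * hecke_coef s j = (zsign s * hecke_coef s j * const_coef s i :: 'k::field spinor endo)"
    "const_coef s i * const_coef s j = (zsign s * const_coef s j * const_coef s i :: 'k::field spinor endo)"
proof -
  have "clifford k * clifford l = - (clifford l * clifford k :: 'k spinor endo)"
    if "k \<in> {i, Suc i}" "l \<in> {j, Suc j}" for k l
    using assms that by (intro clifford_anticommute) auto
  then have "clifford i * clifford j = - (clifford j * clifford i :: 'k spinor endo)"
    "clifford i * clifford (Suc j) = - (clifford (Suc j) * clifford i :: 'k spinor endo)"
    "clifford (Suc i) * clifford j = - (clifford j * clifford (Suc i) :: 'k spinor endo)"
    "clifford (Suc i) * clifford (Suc j) = - (clifford (Suc j) * clifford (Suc i) :: 'k spinor endo)"
    by simp_all
  then show "hecke_coef s i * hecke_coef s j = (zsign s * hecke_coef s j * hecke_coef s i :: 'k spinor endo)"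
    "hecke_coef s i * const_coef s j = (zsign s * const_coef s j * hecke_coef s i :: 'k spinor endo)"
    "const_coef s i * hecke_coef s j = (zsign s * hecke_coef s j * const_coef s i :: 'k spinor endo)"
    "const_coef s i * const_coef s j = (zsign s * const_coef s j * const_coef s i :: 'k spinor endo)"
    by (simp_all add: hecke_coef_def const_coef_def zsign_def algebra_simps)
qed

lemma coef_scalar:
  "hecke_coef s i * scalar c = scalar c * hecke_coef s i" "const_coef s i * scalar c = scalar c * const_coef s i"
  by (simp_all add: hecke_coef_def const_coef_def algebra_simps clifford_scalar mult_2 mult_2_right)

lemma scalar_hecke: "fibrewise (scalar c) * hecke q i = hecke q i * fibrewise (scalar c)"
  by (rule fibrewise_hecke) (simp add: scalar_hom(4)[symmetric] mult.commute)

lemma fibrewise_numeral: "fibrewise (zsign s) = zsign s" "fibrewise 3 = 3"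
proof -
  show "fibrewise (zsign s) = zsign s" by (simp add: zsign_def fibrewise_hom)
  have "(3 :: 'r::ring_1) = 1 + 1 + 1" by simp
  then show "fibrewise 3 = 3" by (metis fibrewise_hom(1,3))
qed

lemma fibrewise_comm:
  "hecke q j * fibrewise (hecke_coef s i) = fibrewise (hecke_coef s i) * hecke q j"
  "hecke q j * fibrewise (const_coef s i) = fibrewise (const_coef s i) * hecke q j"
  "fibrewise (hecke_coef s i) * fibrewise (scalar c) = fibrewise (scalar c) * fibrewise (hecke_coef s i)"
  "fibrewise (const_coef s i) * fibrewise (scalar c) = fibrewise (scalar c) * fibrewise (const_coef s i)"
  "hecke q j * fibrewise (scalar c) = fibrewise (scalar c) * hecke q j"
  by (simp_all only: fibrewise_hecke coef_scalar scalar_hecke fibrewise_hom(4)[symmetric])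

lemma twisted_hecke_square:
  assumes "q \<noteq> 0"
  shows "twisted_hecke q s i * twisted_hecke q s i = fibrewise (scalar ((q - inverse q)^2 + 3)) * zsign s + 1"
proof -
  have "twisted_hecke q s i * twisted_hecke q s i =
    (fibrewise (scalar (q - inverse q)) * fibrewise (scalar (q - inverse q)) + 3) * zsign s + 1"
    unfolding twisted_hecke_def
  proof (rule twisted_square)
    show "fibrewise (hecke_coef s i) * fibrewise (hecke_coef s i) = 3 * zsign s + 1"
      by (simp only: fibrewise_hom(4)[symmetric] coef_relations(1))
        (simp add: fibrewise_hom fibrewise_numeral)
    show "fibrewise (const_coef s i) * fibrewise (const_coef s i) = zsign s"
      by (simp only: fibrewise_hom(4)[symmetric] coef_relations(2) fibrewise_numeral)
    show "fibrewise (hecke_coef s i) * fibrewise (const_coef s i) + fibrewise (const_coef s i) * fibrewise (hecke_coef s i) =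
      - (fibrewise (hecke_coef s i) * fibrewise (hecke_coef s i))"
      by (simp only: fibrewise_hom(3-5)[symmetric] coef_relations(3))
  qed (simp_all only: fibrewise_comm hecke_square[OF assms])
  also have "fibrewise (scalar (q - inverse q)) * fibrewise (scalar (q - inverse q)) + 3 =
      fibrewise (scalar ((q - inverse q)^2 + 3))"
  proof -
    have "scalar 3 = (3 :: 'a spinor endo)"
      by (metis numeral_3_eq_3 one_add_one scalar_hom(1,3) numeral_plus_one semiring_norm(5))
    then show ?thesis
      by (simp only: power2_eq_square scalar_hom(3,4) fibrewise_hom(3,4) fibrewise_numeral)
  qed
  finally show ?thesis .
qed

lemma twisted_hecke_commute:
  assumes "\<bar>int i - int j\<bar> > 1"
  shows "twisted_hecke q s i * twisted_hecke q s j = zsign s * twisted_hecke q s j * twisted_hecke q s i"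
  unfolding twisted_hecke_def
proof (rule twisted_commute)
  show "hecke q j * hecke q i = hecke q i * hecke q j"
    using assms hecke_commute[of i j q] hecke_commute[of j i q] by (cases "i < j") auto
  show "zsign s * fibrewise (scalar (q - inverse q)) = fibrewise (scalar (q - inverse q)) * zsign s"
    by (simp add: zsign_def)
qed (simp_all only: fibrewise_comm coef_scalar fibrewise_hom(4)[symmetric] coef_twisted_commute[OF assms] fibrewise_numeral(1)[symmetric])

lemma twisted_hecke_braid:
  assumes "q \<noteq> 0"
  shows "twisted_hecke q s i * twisted_hecke q s (Suc i) * twisted_hecke q s i - twisted_hecke q s (Suc i) * twisted_hecke q s i * twisted_hecke q s (Suc i) =
    fibrewise (scalar ((q - inverse q)^2)) * (twisted_hecke q s (Suc i) - twisted_hecke q s i)"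
proof -
  have "twisted_hecke q s i * twisted_hecke q s (Suc i) * twisted_hecke q s i - twisted_hecke q s (Suc i) * twisted_hecke q s i * twisted_hecke q s (Suc i) =
    fibrewise (scalar (q - inverse q)) * fibrewise (scalar (q - inverse q)) * (twisted_hecke q s (Suc i) - twisted_hecke q s i)"
    unfolding twisted_hecke_def
    by (rule twisted_braid, simp_all only: fibrewise_comm hecke_square[OF assms] hecke_braid[OF assms]
        fibrewise_hom(3-6)[symmetric] coef_scalar coef_relations(4-6,8-10),
       simp_all only: coef_relations(7))
  then show ?thesis
    by (simp only: power2_eq_square scalar_hom(4) fibrewise_hom(4))
qed

section \<open>Independence of standard monomials by leading terms\<close>

text \<open>Words that differ from \<open>f\<close> only in the places \<open>1, \<dots>, k\<close>. Injectivity excludes equal neighbours, so that only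
the triangular part of the Hecke action is seen.\<close>
definition injective_variants :: "nat \<Rightarrow> (nat \<Rightarrow> nat) \<Rightarrow> (nat \<Rightarrow> nat) set" where
  "injective_variants k f = {g. inj g \<and> (\<forall>p. p \<notin> {1..k} \<longrightarrow> g p = f p)}"

lemma injective_variants_self: "inj f \<Longrightarrow> f \<in> injective_variants k f"
  by (simp add: injective_variants_def)

lemma injective_variants_trans: "g \<in> injective_variants k f \<Longrightarrow> k \<le> l \<Longrightarrow> h \<in> injective_variants k g \<Longrightarrow> h \<in> injective_variants l f"
  by (auto simp: injective_variants_def)

lemma injective_variants_above: "g \<in> injective_variants k f \<Longrightarrow> k < p \<Longrightarrow> g p = f p"
  by (auto simp: injective_variants_def)

lemma injective_variants_inj: "g \<in> injective_variants k f \<Longrightarrow> inj g"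
  by (simp add: injective_variants_def)

lemma inj_swap_at: "inj f \<Longrightarrow> inj (swap_at i f)"
  by (rule injI) (auto simp: swap_at_def inj_eq split: if_splits)

lemma swap_at_injective_variants: "g \<in> injective_variants k f \<Longrightarrow> 1 \<le> i \<Longrightarrow> i < k \<Longrightarrow> swap_at i g \<in> injective_variants k f"
proof -
  assume g: "g \<in> injective_variants k f" and i: "1 \<le> i" "i < k"
  have "swap_at i g p = f p" if "p \<notin> {1..k}" for p
  proof -
    have "p \<noteq> i" "p \<noteq> Suc i" using that i by auto
    then show ?thesis using g that unfolding injective_variants_def by simp
  qed
  then show ?thesis using g inj_swap_at unfolding injective_variants_def by blast
qed

text \<open>The letter in place \<open>n + 1 - a\<close> moves to place \<open>n + 1\<close>, and those after it move one place down.\<close>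
fun move_last :: "nat \<Rightarrow> nat \<Rightarrow> (nat \<Rightarrow> nat) \<Rightarrow> nat \<Rightarrow> nat" where
  "move_last n 0 f = f"
| "move_last n (Suc a) f = swap_at n (move_last (n - 1) a f)"

lemma move_last_injective_variants: "inj f \<Longrightarrow> a \<le> n \<Longrightarrow> move_last n a f \<in> injective_variants (Suc n) f"
proof (induction a arbitrary: n)
  case 0
  then show ?case by (simp add: injective_variants_self)
next
  case (Suc a)
  then obtain n' where n: "n = Suc n'" by (cases n) auto
  have "move_last n' a f \<in> injective_variants (Suc n') f" using Suc n by simp
  then have "move_last n' a f \<in> injective_variants (Suc n) f"
    using injective_variants_trans[of f "Suc n'" f "Suc n" "move_last n' a f"] injective_variants_self[OF Suc.prems(1)] n by simp
  then show ?case using swap_at_injective_variants[of _ "Suc n" f n] n by simp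
qed

lemma move_last_last: "a \<le> n \<Longrightarrow> move_last n a f (Suc n) = f (Suc n - a)"
proof (induction a arbitrary: n)
  case (Suc a)
  then show ?case by (cases n) auto
qed simp

text \<open>The operator \<open>X\<^sub>i\<close> transports a function along the exchange of two neighbouring letters, with an injective
coefficient, up to a diagonal correction.\<close>
locale triangular_operators =
  fixes X :: "nat \<Rightarrow> 'k::field wordspinor endo" and A :: "nat \<Rightarrow> 'k spinor endo"
    and B :: "nat \<Rightarrow> (nat \<Rightarrow> nat) \<Rightarrow> 'k spinor endo"
  assumes X_app: "inj f \<Longrightarrow> app (X i) \<phi> f = app (A i) (\<phi> (swap_at i f)) + app (B i f) (\<phi> f)"
    and A_inj: "app (A i) v = 0 \<Longrightarrow> v = 0"
begin

fun leading_coef :: "nat \<Rightarrow> nat \<Rightarrow> 'k spinor endo" where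
  "leading_coef n 0 = 1"
| "leading_coef n (Suc a) = A n * leading_coef (n - 1) a"

lemma leading_coef_inj: "app (leading_coef n a) v = 0 \<Longrightarrow> v = 0"
proof (induction a arbitrary: n)
  case (Suc a)
  have "app (leading_coef (n - 1) a) v = 0"
    by (rule A_inj[of n]) (use Suc.prems in \<open>simp only: leading_coef.simps app_simps\<close>)
  then show ?case by (rule Suc.IH)
qed simp

lemma X_vanish:
  assumes "\<And>g. g \<in> injective_variants k f \<Longrightarrow> \<phi> g = 0" "1 \<le> i" "i < k" "g \<in> injective_variants k f"
  shows "app (X i) \<phi> g = 0"
  using assms X_app[of g i \<phi>] swap_at_injective_variants[of g k f i] injective_variants_inj[of g k f] by simp

lemma desc_product_vanish:
  assumes "\<And>g. g \<in> injective_variants k f \<Longrightarrow> \<phi> g = 0" "m < k" "a \<le> m" "g \<in> injective_variants k f"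
  shows "app (desc_product X m a) \<phi> g = 0"
  using assms
proof (induction a arbitrary: \<phi> g)
  case (Suc a)
  have "app (desc_product X m a) (app (X (m - a)) \<phi>) g = 0"
  proof (rule Suc.IH)
    show "app (X (m - a)) \<phi> h = 0" if "h \<in> injective_variants k f" for h
      using Suc.prems that by (intro X_vanish[of k f]) auto
  qed (use Suc.prems in auto)
  then show ?case by (simp add: desc_product_Suc)
qed simp

lemma std_monomial_vanish:
  assumes "1 \<le> m" "\<And>g. g \<in> injective_variants m f \<Longrightarrow> \<phi> g = 0" "\<And>i. 1 \<le> i \<Longrightarrow> i < m \<Longrightarrow> a i \<le> i" "g \<in> injective_variants m f"
  shows "app (std_monomial X m a) \<phi> g = 0"
proof -
  have "1 \<le> l \<Longrightarrow> l \<le> m \<Longrightarrow> (\<forall>g. g \<in> injective_variants m f \<longrightarrow> \<phi> g = 0) \<Longrightarrow>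
      g \<in> injective_variants m f \<Longrightarrow> app (std_monomial X l a) \<phi> g = 0" for l \<phi> g
  proof (induction l arbitrary: \<phi> g)
    case (Suc l)
    show ?case
    proof (cases "l = 0")
      case False
      have "app (std_monomial X l a) (app (desc_product X l (a l)) \<phi>) g = 0"
      proof (rule Suc.IH)
        show "\<forall>g. g \<in> injective_variants m f \<longrightarrow> app (desc_product X l (a l)) \<phi> g = 0"
          using Suc.prems False assms(3)[of l] by (intro allI impI desc_product_vanish[of m f]) auto
      qed (use Suc.prems False in auto)
      then show ?thesis using False by (simp add: std_monomial_Suc)
    qed (use Suc.prems in simp)
  qed simp
  from this[of m \<phi> g] assms show ?thesis by simp
qed

text \<open>Each factor of a descending product either moves on the letter that has just arrived or leaves it behind. So
\<open>a\<close> factors starting from the word \<open>f\<close> can bring to place \<open>n + 1\<close> only letters from the last \<open>a + 1\<close> places, and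
the farthest of these only when every factor moves it. Hence among the words that end in the letter from place
\<open>n + 1 - A'\<close> a product with \<open>a \<le> A'\<close> factors sees at most one, \<open>move_last n A' f\<close>, and that one only for \<open>a = A'\<close>.\<close>
lemma desc_product_delta:
  assumes "inj f" and "\<And>g. g \<in> injective_variants (Suc n) f \<Longrightarrow> \<phi> g = (if g = f then u else 0)"
    and "a \<le> A'" "A' \<le> n" "g \<in> injective_variants (Suc n) f" "g (Suc n) = f (Suc n - A')"
  shows "app (desc_product X n a) \<phi> g = (if a = A' \<and> g = move_last n A' f then app (leading_coef n A') u else 0)"
  using assms(2-)
proof (induction A' arbitrary: n a g)
  case 0
  then show ?case by simp
next
  case (Suc A')
  note \<phi> = Suc.prems(1) and g = Suc.prems(4,5)
  obtain n' where n: "n = Suc n'" using Suc.prems(3) by (cases n) auto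
  have "f (Suc n - Suc A') \<noteq> f (Suc n)"
    using injD[OF assms(1), of "Suc n - Suc A'" "Suc n"] n Suc.prems by auto
  then have gn: "g (Suc n) \<noteq> f (Suc n)" using g by simp
  show ?case
  proof (cases a)
    case 0
    then show ?thesis using \<phi>[OF g(1)] gn by auto
  next
    case (Suc a')
    define \<psi> where "\<psi> = app (desc_product X n' a') \<phi>"
    let ?h = "swap_at n g"
    have a': "a' \<le> n'" "a' \<le> A'" using Suc Suc.prems n by auto
    have gi: "inj g" using g injective_variants_inj by blast
    have h: "?h \<in> injective_variants (Suc n) f" using g n by (intro swap_at_injective_variants) auto
    have vanish: "\<psi> k = 0" if k: "k \<in> injective_variants (Suc n) f" "k (Suc n) \<noteq> f (Suc n)" for k
    proof -
      have "\<phi> l = 0" if l: "l \<in> injective_variants n k" for l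
      proof -
        have "l (Suc n) \<noteq> f (Suc n)" using injective_variants_above[OF l, of "Suc n"] k(2) by simp
        moreover have "l \<in> injective_variants (Suc n) f" using l k(1) by (auto simp: injective_variants_def)
        ultimately show ?thesis using \<phi>[of l] by auto
      qed
      then show ?thesis unfolding \<psi>_def
        using a' n injective_variants_self[OF injective_variants_inj[OF k(1)]]
          by (intro desc_product_vanish[of n k]) auto
    qed
    have "app (desc_product X n a) \<phi> g = app (A n) (\<psi> ?h) + app (B n g) (\<psi> g)"
      using Suc n X_app[OF gi] by (simp add: desc_product_Suc_left \<psi>_def)
    also have "\<dots> = app (A n) (\<psi> ?h)" using vanish[OF g(1) gn] by simp
    also have "\<dots> = (if a = Suc A' \<and> g = move_last n (Suc A') f then app (leading_coef n (Suc A')) u else 0)"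
    proof (cases "g n = f (Suc n)")
      case True
      have hn: "?h \<in> injective_variants (Suc n') f"
      proof -
        have "?h p = f p" if "p \<notin> {1..Suc n'}" for p
        proof (cases "p = Suc n")
          case False
          then have "p \<notin> {1..Suc n}" using that n by auto
          then show ?thesis using h unfolding injective_variants_def by blast
        qed (use True in simp)
        then show ?thesis using h unfolding injective_variants_def by blast
      qed
      have "\<psi> ?h = (if a' = A' \<and> ?h = move_last n' A' f then app (leading_coef n' A') u else 0)"
        unfolding \<psi>_def
      proof (rule Suc.IH)
        show "\<phi> k = (if k = f then u else 0)" if "k \<in> injective_variants (Suc n') f" for k
          using that n by (intro \<phi>) (auto simp: injective_variants_def)
        show "?h (Suc n') = f (Suc n' - A')" using g n by simp
      qed (use a' Suc.prems n hn in auto)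
      moreover have "?h = move_last n' A' f \<longleftrightarrow> g = move_last n (Suc A') f"
        using n by (metis move_last.simps(2) diff_Suc_1 swap_at_involution)
      ultimately show ?thesis using Suc n by simp
    next
      case False
      have "\<psi> ?h = 0" using False by (intro vanish h) simp
      moreover have "g \<noteq> move_last n (Suc A') f"
      proof
        assume "g = move_last n (Suc A') f"
        then have "?h = move_last n' A' f" using n by simp
        then have "?h \<in> injective_variants n f" using move_last_injective_variants[OF assms(1), of A' n'] Suc.prems n by simp
        then have "?h (Suc n) = f (Suc n)" by (rule injective_variants_above) simp
        then show False using False by simp
      qed
      ultimately show ?thesis by simp
    qed
    finally show ?thesis .
  qed
qed

text \<open>Given a dependency, let \<open>A'\<close> be the largest last exponent that occurs in it. On the words whose last letter
comes from place \<open>n + 1 - A'\<close> the monomials with smaller last exponent vanish, while the others act on a function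
that is again concentrated in one word. The remaining factors do not touch the last place, which reduces the claim to
fewer places.\<close>
lemma std_monomial_independent:
  assumes "1 \<le> n" "finite E" "\<And>a i. a \<in> E \<Longrightarrow> 1 \<le> i \<Longrightarrow> i < n \<Longrightarrow> a i \<le> i"
    and "\<And>a b. a \<in> E \<Longrightarrow> b \<in> E \<Longrightarrow> (\<And>i. 1 \<le> i \<Longrightarrow> i < n \<Longrightarrow> a i = b i) \<Longrightarrow> a = b"
    and "inj f" "u \<noteq> 0" "\<And>g. g \<in> injective_variants n f \<Longrightarrow> \<phi> g = (if g = f then u else 0)"
    and "\<And>g S. g \<in> injective_variants n f \<Longrightarrow> (\<Sum>a\<in>E. c a * app (std_monomial X n a) \<phi> g S) = 0"
  shows "\<forall>a\<in>E. c a = 0"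
  using assms
proof (induction n arbitrary: E f u \<phi>)
  case 0
  from \<open>1 \<le> (0 :: nat)\<close> show ?case by simp
next
  case (Suc n)
  show ?case
  proof (cases "n = 0")
    case True
    show ?thesis
    proof
      fix a assume a: "a \<in> E"
      have "b = a" if "b \<in> E" for b
        by (rule Suc.prems(4)[OF that a]) (use True in simp)
      with a have "E = {a}" by blast
      moreover obtain S where "u S \<noteq> 0" using Suc.prems(6) by (auto simp: fun_eq_iff)
      ultimately show "c a = 0"
      proof -
        have f: "f \<in> injective_variants (Suc n) f" by (rule injective_variants_self[OF Suc.prems(5)])
        have "c a * \<phi> f S = 0" using Suc.prems(8)[OF f, of S] \<open>E = {a}\<close> True by simp
        moreover have "\<phi> f = u" using Suc.prems(7)[OF f] by simp
        ultimately show ?thesis using \<open>u S \<noteq> 0\<close> by simp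
      qed
    qed
  next
    case n0: False
    show ?thesis
    proof (rule ccontr)
      assume neg: "\<not> (\<forall>a\<in>E. c a = 0)"
      define E' where "E' = {a \<in> E. c a \<noteq> 0}"
      define A' where "A' = Max ((\<lambda>a. a n) ` E')"
      define E'' where "E'' = {a \<in> E'. a n = A'}"
      have E''_sub: "E'' \<subseteq> E" by (auto simp: E''_def E'_def)
      have fin: "finite E'" and ne: "E' \<noteq> {}" using Suc.prems(2) neg by (auto simp: E'_def)
      have "A' \<in> (\<lambda>a. a n) ` E'" unfolding A'_def
        by (rule Max_in) (use fin ne in simp_all)
      then have ne'': "E'' \<noteq> {}" by (auto simp: E''_def)
      have le: "a n \<le> A'" if "a \<in> E'" for a unfolding A'_def using fin that by (intro Max_ge) auto
      obtain a0 where a0: "a0 \<in> E''" using ne'' by blast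
      then have An: "A' \<le> n" using Suc.prems(3)[of a0 n] n0 by (simp add: E''_def E'_def)
      define \<psi> where "\<psi> = app (desc_product X n A') \<phi>"
      define f1 where "f1 = move_last n A' f"
      have f1: "f1 \<in> injective_variants (Suc n) f" unfolding f1_def
        by (rule move_last_injective_variants[OF Suc.prems(5) An])
      have f1n: "f1 (Suc n) = f (Suc n - A')" unfolding f1_def by (rule move_last_last[OF An])
      have sub: "g \<in> injective_variants (Suc n) f \<and> g (Suc n) = f (Suc n - A')" if "g \<in> injective_variants n f1" for g
      proof
        show "g \<in> injective_variants (Suc n) f"
        proof -
          have "g p = f p" if "p \<notin> {1..Suc n}" for p
          proof -
            have "p \<notin> {1..n}" using that by auto
            then have "g p = f1 p" using \<open>g \<in> injective_variants n f1\<close> unfolding injective_variants_def by blast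
            also have "f1 p = f p" using f1 that unfolding injective_variants_def by blast
            finally show ?thesis .
          qed
          then show ?thesis using injective_variants_inj[OF that] unfolding injective_variants_def by blast
        qed
        show "g (Suc n) = f (Suc n - A')"
          using injective_variants_above[OF that, of "Suc n"] f1n by simp
      qed
      have delta: "app (desc_product X n a) \<phi> g = (if a = A' \<and> g = f1 then app (leading_coef n A') u else 0)"
        if "g \<in> injective_variants n f1" "a \<le> A'" for g a
        unfolding f1_def
      proof (rule desc_product_delta[OF Suc.prems(5) _ that(2) An])
        show "\<phi> g = (if g = f then u else 0)" if "g \<in> injective_variants (Suc n) f" for g
          using that by (rule Suc.prems(7))
      qed (use sub[OF that(1)] in blast)+
      have "\<forall>a\<in>E''. c a = 0"
      proof (rule Suc.IH)
        show "finite E''" using fin by (simp add: E''_def)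
        show "a i \<le> i" if "a \<in> E''" "1 \<le> i" "i < n" for a i
          using that Suc.prems(3) by (simp add: E''_def E'_def)
        show "a = b" if "a \<in> E''" "b \<in> E''" "\<And>i. 1 \<le> i \<Longrightarrow> i < n \<Longrightarrow> a i = b i" for a b
        proof (rule Suc.prems(4))
          show "a i = b i" if "1 \<le> i" "i < Suc n" for i
            using that \<open>a \<in> E''\<close> \<open>b \<in> E''\<close> \<open>\<And>i. 1 \<le> i \<Longrightarrow> i < n \<Longrightarrow> a i = b i\<close>
            by (cases "i = n") (auto simp: E''_def)
        qed (use that in \<open>simp_all add: E''_def E'_def\<close>)
        show "inj f1" using f1 injective_variants_inj by blast
        show "app (leading_coef n A') u \<noteq> 0" using leading_coef_inj Suc.prems(6) by blast
        show "\<psi> g = (if g = f1 then app (leading_coef n A') u else 0)" if "g \<in> injective_variants n f1" for g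
          using delta[OF that order_refl] by (simp add: \<psi>_def)
        show "(\<Sum>a\<in>E''. c a * app (std_monomial X n a) \<psi> g S) = 0" if g: "g \<in> injective_variants n f1" for g S
        proof -
          have "(\<Sum>a\<in>E. c a * app (std_monomial X (Suc n) a) \<phi> g S) = (\<Sum>a\<in>E''. c a * app (std_monomial X n a) \<psi> g S)"
          proof (rule sum.mono_neutral_cong_right)
            show "\<forall>a\<in>E - E''. c a * app (std_monomial X (Suc n) a) \<phi> g S = 0"
            proof
              fix a assume a: "a \<in> E - E''"
              show "c a * app (std_monomial X (Suc n) a) \<phi> g S = 0"
              proof (cases "a \<in> E'")
                case True
                then have lt: "a n < A'" using le[OF True] a by (auto simp: E''_def)
                have "app (std_monomial X n a) (app (desc_product X n (a n)) \<phi>) g = 0"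
                proof (rule std_monomial_vanish)
                  show "app (desc_product X n (a n)) \<phi> h = 0" if "h \<in> injective_variants n f1" for h
                    using delta[OF that, of "a n"] lt by simp
                qed (use n0 g a Suc.prems(3) in simp_all)
                then show ?thesis using n0 by (simp add: std_monomial_Suc)
              next
                case False
                then show ?thesis using a by (simp add: E'_def)
              qed
            qed
            show "c a * app (std_monomial X (Suc n) a) \<phi> g S = c a * app (std_monomial X n a) \<psi> g S" if "a \<in> E''" for a
              using that n0 by (simp add: std_monomial_Suc \<psi>_def E''_def)
          qed (use Suc.prems(2) E''_sub in simp_all)
          then show ?thesis using Suc.prems(8)[of g S] sub[OF g] by simp
        qed
      qed (use n0 in simp)
      then show False using a0 unfolding E''_def E'_def by blast
    qed
  qed
qed

end

lemma app_double_zero: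
  assumes "(2 :: 'k::field) \<noteq> 0" "v + v = (0 :: 'k spinor)"
  shows "v = 0"
proof
  fix S
  have "v S + v S = 0" using assms(2) by (metis plus_fun_apply zero_fun_apply)
  then have "2 * v S = 0" by simp
  then show "v S = 0 S" using assms(1) by simp
qed

lemma hecke_coef_inj:
  assumes two: "(2 :: 'k::field) \<noteq> 0" and v: "app (hecke_coef s i) v = (0 :: 'k spinor)"
  shows "v = 0"
proof -
  have "hecke_coef s i * hecke_coef s i = (if s then - (1 + 1) else (1 + 1) * (1 + 1) :: 'k spinor endo)"
    unfolding coef_relations(1) by (simp add: zsign_def)
  moreover have "app (hecke_coef s i * hecke_coef s i) v = 0" using v by (simp only: app_simps app_zero)
  ultimately have "v + v = 0 \<or> (v + v) + (v + v) = 0"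
    by (cases s) (simp_all only: app_simps if_True if_False neg_equal_0_iff_equal simp_thms)
  then show ?thesis using app_double_zero[OF two] by blast
qed

lemma twisted_hecke_triangular:
  assumes "(2 :: 'k::field) \<noteq> 0"
  shows "triangular_operators (twisted_hecke (q :: 'k) s) (hecke_coef s) (\<lambda>i f. (if f (Suc i) < f i then hecke_coef s i * scalar (q - inverse q) else 0)
      + scalar (q - inverse q) * const_coef s i)"
proof
  fix f :: "nat \<Rightarrow> nat" and i :: nat and \<phi> :: "'k wordspinor"
  assume "inj f"
  then have "f i \<noteq> f (Suc i)" by (simp add: inj_eq)
  then show "app (twisted_hecke q s i) \<phi> f = app (hecke_coef s i) (\<phi> (swap_at i f)) +
      app ((if f (Suc i) < f i then hecke_coef s i * scalar (q - inverse q) else 0) + scalar (q - inverse q) * const_coef s i) (\<phi> f)"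
    by (simp add: twisted_hecke_def app_fibrewise app_hecke)
next
  show "v = 0" if "app (hecke_coef s i) v = 0" for i and v :: "'k spinor"
    using hecke_coef_inj[OF assms that] .
qed

lemma even_exps_le: "a \<in> even_exps n \<Longrightarrow> 1 \<le> i \<Longrightarrow> i < n \<Longrightarrow> a i \<le> i"
  unfolding even_exps_def by (auto simp: PiE_iff)

lemma even_exps_eqI:
  assumes "a \<in> even_exps n" "b \<in> even_exps n" "\<And>i. 1 \<le> i \<Longrightarrow> i < n \<Longrightarrow> a i = b i"
  shows "a = b"
proof (rule PiE_ext)
  show "a \<in> PiE {1..n-1} (\<lambda>i. {0..i})" "b \<in> PiE {1..n-1} (\<lambda>i. {0..i})"
    using assms(1,2) by (simp_all add: even_exps_def)
  show "a i = b i" if "i \<in> {1..n-1}" for i using that by (intro assms(3)) auto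
qed

text \<open>The test vector is concentrated in the identity word.\<close>
lemma twisted_hecke_independent:
  fixes q :: "'k::field"
  assumes "(2 :: 'k) \<noteq> 0" "1 \<le> n"
    and sum: "(\<Sum>a\<in>even_exps n. fibrewise (scalar (c a)) * std_monomial (twisted_hecke q s) n a) = 0"
  shows "\<forall>a\<in>even_exps n. c a = 0"
proof -
  interpret triangular_operators "twisted_hecke q s" "hecke_coef s" "\<lambda>i f. (if f (Suc i) < f i then hecke_coef s i * scalar (q - inverse q) else 0)
      + scalar (q - inverse q) * const_coef s i"
    by (rule twisted_hecke_triangular[OF assms(1)])
  define u :: "'k spinor" where "u S = (if S = {} then 1 else 0)" for S
  define \<phi> :: "'k wordspinor" where "\<phi> f = (if f = id then u else 0)" for f
  have u: "u \<noteq> 0" 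
  proof
    assume "u = 0"
    then have "u {} = 0" by simp
    then show False by (simp add: u_def)
  qed
  have app_sum: "app (\<Sum>a\<in>I. h a) \<phi> g S = (\<Sum>a\<in>I. app (h a) \<phi> g S)" for I :: "(nat \<Rightarrow> nat) set" and h g S
    by (induction I rule: infinite_finite_induct) simp_all
  have zero: "(\<Sum>a\<in>even_exps n. c a * app (std_monomial (twisted_hecke q s) n a) \<phi> g S) = 0" for g S
    using arg_cong[OF sum, of "\<lambda>F. app F \<phi> g S"] by (simp add: app_sum app_fibrewise app_scalar)
  show ?thesis
  proof (rule std_monomial_independent[OF assms(2) finite_even_exps])
    show "inj (id :: nat \<Rightarrow> nat)" by simp
    show "u \<noteq> 0" by (rule u)
    show "\<phi> g = (if g = id then u else 0)" for g by (simp add: \<phi>_def)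
    show "a i \<le> i" if "a \<in> even_exps n" "1 \<le> i" "i < n" for a i using that by (rule even_exps_le)
    show "a = b" if "a \<in> even_exps n" "b \<in> even_exps n" "\<And>i. 1 \<le> i \<Longrightarrow> i < n \<Longrightarrow> a i = b i" for a b
      using that by (rule even_exps_eqI)
  qed (rule zero)
qed

section \<open>Counting exponents of even sum\<close>

text \<open>Exchanging the values 0 and 1 of the first exponent changes the parity of the sum.\<close>
lemma card_even_exps:
  assumes "2 \<le> n"
  shows "2 * card (even_exps n) = fact n"
proof -
  define P where "P = PiE {1..n-1} (\<lambda>i. {0..i})"
  define odds where "odds = {a \<in> P. odd (\<Sum>i\<in>{1..n-1}. a i)}"
  define \<tau> :: "(nat \<Rightarrow> nat) \<Rightarrow> nat \<Rightarrow> nat" where "\<tau> a = a(1 := 1 - a 1)" for a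
  have one: "1 \<in> {1..n-1}" using assms by auto
  have finP: "finite P" unfolding P_def by (intro finite_PiE) auto
  have a1: "a 1 \<le> 1" if "a \<in> P" for a using PiE_mem[OF that[unfolded P_def] one] by simp
  have \<tau>P: "\<tau> a \<in> P" if "a \<in> P" for a
    using that one unfolding P_def \<tau>_def by (auto simp: PiE_iff extensional_def)
  have \<tau>\<tau>: "\<tau> (\<tau> a) = a" if "a \<in> P" for a
    using a1[OF that] by (auto simp: \<tau>_def)
  have parity: "even (\<Sum>i\<in>{1..n-1}. \<tau> a i) \<longleftrightarrow> odd (\<Sum>i\<in>{1..n-1}. a i)" if "a \<in> P" for a
  proof -
    have "(\<Sum>i\<in>{1..n-1}. b i) = b 1 + (\<Sum>i\<in>{1..n-1} - {1}. b i)" for b :: "nat \<Rightarrow> nat"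
      by (rule sum.remove[OF _ one]) simp
    note this[of a] this[of "\<tau> a"]
    moreover have "(\<Sum>i\<in>{1..n-1} - {1}. \<tau> a i) = (\<Sum>i\<in>{1..n-1} - {1}. a i)"
      by (intro sum.cong) (auto simp: \<tau>_def)
    moreover have "\<tau> a 1 = 1 - a 1" by (simp add: \<tau>_def)
    moreover have "a 1 = 0 \<or> a 1 = 1" using a1[OF that] by linarith
    ultimately show ?thesis by auto
  qed
  have "bij_betw \<tau> (even_exps n) odds"
  proof (rule bij_betw_byWitness[where f' = \<tau>])
    have ev: "even_exps n = {a \<in> P. even (\<Sum>i\<in>{1..n-1}. a i)}" by (simp add: even_exps_def P_def)
    show "\<forall>a\<in>even_exps n. \<tau> (\<tau> a) = a" "\<forall>a\<in>odds. \<tau> (\<tau> a) = a"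
      using \<tau>\<tau> unfolding ev odds_def by blast+
    show "\<tau> ` even_exps n \<subseteq> odds" "\<tau> ` odds \<subseteq> even_exps n"
      using \<tau>P parity unfolding ev odds_def by blast+
  qed
  then have "card (even_exps n) = card odds" by (rule bij_betw_same_card)
  moreover have "P = even_exps n \<union> odds" "even_exps n \<inter> odds = {}"
    by (auto simp: even_exps_def odds_def P_def)
  ultimately have "card P = 2 * card (even_exps n)"
    using finP by (metis card_Un_disjoint finite_Un mult_2)
  moreover have "card P = fact n"
  proof -
    have "card P = (\<Prod>i\<in>{1..n-1}. Suc i)" unfolding P_def by (simp add: card_PiE)
    also have "\<dots> = fact n"
    proof -
      obtain m where "n = Suc m" using assms by (cases n) auto
      moreover have "(\<Prod>i\<in>{1..m}. Suc i) = fact (Suc m)"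
        by (induction m) (simp_all add: algebra_simps)
      ultimately show ?thesis by simp
    qed
    finally show ?thesis .
  qed
  ultimately show ?thesis by simp
qed

section \<open>The spin and covering Hecke algebras\<close>

lemma qq_nonzero: "qq \<noteq> 0"
  by (simp add: qq_def Zero_fract_def eq_fract)

lemma two_nonzero: "(2 :: Cq) \<noteq> 0"
proof -
  have "(2 :: Cq) = Fract 1 1 + Fract 1 1" by (simp add: One_fract_def[symmetric])
  also have "\<dots> = Fract 2 1" by simp
  finally have two: "(2 :: Cq) = Fract 2 1" .
  have "Fract 2 1 \<noteq> Fract 0 (1 :: complex poly)" by (subst eq_fract) simp_all
  then show ?thesis unfolding two Zero_fract_def .
qed

lemma eps_square: "eps ^ 2 + 3 = qq ^ 2 + inverse qq ^ 2 + 1"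
proof -
  have "qq * inverse qq = 1" using qq_nonzero by simp
  then show ?thesis by (simp add: eps_def power2_eq_square algebra_simps)
qed

lemma rel_in_ideal:
  assumes rels: "\<And>l r. (l, r) \<in> S \<Longrightarrow> l \<in> carrier (free_alg X) \<and> r \<in> carrier (free_alg X)"
    and "(l, r) \<in> S"
  shows "l - r \<in> rel_ideal X S"
proof -
  have "{l - r | l r. (l, r) \<in> S} \<subseteq> carrier (free_alg X)"
    using rels by (auto simp: free_alg_minus_closed)
  from ring.genideal_self[OF free_alg_ring this] show ?thesis
    using assms(2) unfolding rel_ideal_def by blast
qed

lemma basis_family_cong:
  assumes "\<And>i. i \<in> I \<Longrightarrow> f i = g i"
  shows "basis_family K V f I \<longleftrightarrow> basis_family K V g I"
proof -
  have "inj_on f I = inj_on g I" "f ` I = g ` I" using assms by (auto intro!: inj_on_cong)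
  then show ?thesis unfolding basis_family_def by simp
qed

lemma scalar_action_twisted_hecke: 
  assumes "\<And>x c. \<rho> x * fibrewise (scalar c) = fibrewise (scalar c) * \<rho> x"
  shows "scalar_action (\<lambda>c. fibrewise (scalar c)) \<rho>"
  by standard (simp_all add: scalar_hom fibrewise_hom assms)

lemma twisted_hecke_scalar: "twisted_hecke q s i * fibrewise (scalar c) = fibrewise (scalar c) * twisted_hecke q s i"
proof -
  have "(a * T + e * g) * F = F * (a * T + e * g)"
    if "T * F = F * T" "a * F = F * a" "e * F = F * e" "g * F = F * g" for a T e g F :: "'r::ring_1"
    by (simp add: algebra_simps that that[THEN commute_assoc])
  note gen = this
  show ?thesis
    unfolding twisted_hecke_def
    by (rule gen[OF fibrewise_comm(5,3) _ fibrewise_comm(4)])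
      (simp only: fibrewise_hom(4)[symmetric] scalar_hom(4)[symmetric] mult.commute)
qed

lemma (in scalar_action) eval_std_monomial: "ev (std_monomial g n a) = std_monomial (\<lambda>i. ev (g i)) n a"
  by (simp add: std_monomial_def desc_product_def eval_prod_list comp_def)

lemma spin_covering_relations:
  "covering_relations (spin_gens n) (rel_ideal (spin_gens n) (spin_rels n)) (- 1) gen (eps ^ 2 + 3) (eps ^ 2) n"
proof (rule covering_relations.intro)
  have rel: "l - r \<in> rel_ideal (spin_gens n) (spin_rels n)" if "(l, r) \<in> spin_rels n" for l r
    by (rule rel_in_ideal[OF _ that]) (rule spin_rels_closed)
  interpret I: ideal "rel_ideal (spin_gens n) (spin_rels n)" "free_alg (spin_gens n)"
    by (rule rel_ideal_ideal[OF spin_rels_closed])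
  have zero: "0 \<in> rel_ideal (spin_gens n) (spin_rels n)"
    using additive_subgroup.zero_closed[OF I.is_additive_subgroup] by simp
  show "ideal (rel_ideal (spin_gens n) (spin_rels n)) (free_alg (spin_gens n))"
    by (rule I.ideal_axioms)
  show "- 1 \<in> carrier (free_alg (spin_gens n))"
    by (intro free_alg_closed)
  show "(- 1) * (- 1) - 1 \<in> rel_ideal (spin_gens n) (spin_rels n)" using zero by simp
  show "- 1 * p - p * - 1 \<in> rel_ideal (spin_gens n) (spin_rels n)" for p using zero by simp
  fix i j :: nat
  assume i: "1 \<le> i"
  show "gen i \<in> carrier (free_alg (spin_gens n))" if "i < n"
    using i that by (intro gen_closed) (auto simp: spin_gens_def)
  show "gen i * gen i - (scal (eps ^ 2 + 3) * - 1 + 1) \<in> rel_ideal (spin_gens n) (spin_rels n)" if "i < n"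
  proof -
    have "- (eps ^ 2) - 2 = - (eps ^ 2 + 3) + 1" by simp
    then have "scal (- (eps ^ 2) - 2) = (scal (- (eps ^ 2 + 3) + 1) :: (Cq, nat) ncpoly)" by (simp only:)
    also have "\<dots> = scal (eps ^ 2 + 3) * - 1 + 1" by (simp only: scal_add scal_uminus scal_1) simp
    moreover have "gen i * gen i - scal (- (eps ^ 2) - 2) \<in> rel_ideal (spin_gens n) (spin_rels n)"
      by (rule rel) (use i that in \<open>auto simp: spin_rels_def\<close>)
    ultimately show ?thesis by simp
  qed
  show "gen i * gen j - - 1 * gen j * gen i \<in> rel_ideal (spin_gens n) (spin_rels n)"
    if "i < n" "1 \<le> j" "j < n" "\<bar>int i - int j\<bar> > 1"
  proof -
    have "(gen i * gen j, - (gen j * gen i)) \<in> spin_rels n"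
      using i that unfolding spin_rels_def by fastforce
    from rel[OF this] show ?thesis by simp
  qed
  show "gen i * gen (Suc i) * gen i - gen (Suc i) * gen i * gen (Suc i) - scal (eps ^ 2) * (gen (Suc i) - gen i)
      \<in> rel_ideal (spin_gens n) (spin_rels n)" if "Suc i < n"
    by (rule rel) (use i that in \<open>auto simp: spin_rels_def\<close>)
qed

lemma cover_covering_relations:
  "covering_relations (cover_gens n) (rel_ideal (cover_gens n) (cover_rels n)) (gen CZ) (\<lambda>i. gen (CT i)) (eps ^ 2 + 3) (eps ^ 2) n"
proof (rule covering_relations.intro)
  have rel: "l - r \<in> rel_ideal (cover_gens n) (cover_rels n)" if "(l, r) \<in> cover_rels n" for l r
    by (rule rel_in_ideal[OF _ that]) (rule cover_rels_closed)
  let ?J = "rel_ideal (cover_gens n) (cover_rels n)" and ?C = "carrier (free_alg (cover_gens n)) :: (Cq, cover_gen) ncpoly set"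
  let ?z = "gen CZ :: (Cq, cover_gen) ncpoly"
  interpret I: ideal ?J "free_alg (cover_gens n)"
    by (rule rel_ideal_ideal[OF cover_rels_closed])
  have zero: "0 \<in> ?J"
    using additive_subgroup.zero_closed[OF I.is_additive_subgroup] by simp
  have add: "p + q \<in> ?J" if "p \<in> ?J" "q \<in> ?J" for p q
    using additive_subgroup.a_closed[OF I.is_additive_subgroup that] by simp
  have lmult: "r * p \<in> ?J" if "p \<in> ?J" "r \<in> ?C" for p r using I.I_l_closed[OF that] by simp
  have rmult: "p * r \<in> ?J" if "p \<in> ?J" "r \<in> ?C" for p r using I.I_r_closed[OF that] by simp
  show "ideal ?J (free_alg (cover_gens n))" by (rule I.ideal_axioms)
  show z: "?z \<in> ?C" by (intro gen_closed) (simp add: cover_gens_def)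
  show "?z * ?z - 1 \<in> ?J"
    by (rule rel) (unfold cover_rels_def, blast)
  show "?z * p - p * ?z \<in> ?J" if p: "p \<in> ?C" for p
  proof -
    define L where "L (\<pi> :: bool) = {p \<in> ?C. ?z * p - p * ?z \<in> ?J}" for \<pi>
    have "p \<in> free_even (cover_gens n) (\<lambda>_. False)" using p by (simp add: free_even_def)
    then have "p \<in> L True"
    proof (rule free_even_induct)
      show "0 \<in> L True" by (simp add: L_def zero free_alg_closed)
      show "scal c \<in> L True" for c by (simp add: L_def scal_commute zero free_alg_closed)
      show "p + q \<in> L True" if "p \<in> L True" "q \<in> L True" for p q
        using that add[of "?z * p - p * ?z" "?z * q - q * ?z"]
          by (simp add: L_def free_alg_closed algebra_simps)
      show "p * gen x \<in> L (\<pi> = (\<not> False))" if "p \<in> L \<pi>" "x \<in> cover_gens n" for p x \<pi>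
      proof -
        have x: "gen x \<in> ?C" using that by (intro gen_closed)
        have "?z * gen x - gen x * ?z \<in> ?J"
        proof (cases x)
          case CZ
          then show ?thesis using zero by simp
        next
          case (CT i)
          then show ?thesis using that(2) by (intro rel) (auto simp: cover_rels_def cover_gens_def)
        qed
        then have "(?z * p - p * ?z) * gen x + p * (?z * gen x - gen x * ?z) \<in> ?J"
          using that(1) x by (intro add lmult rmult) (simp_all add: L_def)
        then show ?thesis using that(1) x by (simp add: L_def free_alg_closed algebra_simps)
      qed
    qed
    then show ?thesis by (simp add: L_def)
  qed
  fix i j :: nat
  assume i: "1 \<le> i"
  show "gen (CT i) \<in> ?C" if "i < n"
    using i that by (intro gen_closed) (auto simp: cover_gens_def)
  show "gen (CT i) * gen (CT i) - (scal (eps ^ 2 + 3) * ?z + 1) \<in> ?J" if "i < n"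
    unfolding eps_square by (rule rel) (use i that in \<open>auto simp: cover_rels_def\<close>)
  show "gen (CT i) * gen (CT j) - ?z * gen (CT j) * gen (CT i) \<in> ?J"
    if "i < n" "1 \<le> j" "j < n" "\<bar>int i - int j\<bar> > 1"
  proof (rule rel)
    show "(gen (CT i) * gen (CT j), ?z * gen (CT j) * gen (CT i)) \<in> cover_rels n"
      using i that unfolding cover_rels_def by fastforce
  qed
  show "gen (CT i) * gen (CT (Suc i)) * gen (CT i) - gen (CT (Suc i)) * gen (CT i) * gen (CT (Suc i))
      - scal (eps ^ 2) * (gen (CT (Suc i)) - gen (CT i)) \<in> ?J" if "Suc i < n"
    by (rule rel) (use i that in \<open>auto simp: cover_rels_def\<close>)
qed

text \<open>The two representations of the covering algebra, in which \<open>z\<close> acts as \<open>-1\<close> and as \<open>1\<close>.\<close>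
definition cover_letter :: "bool \<Rightarrow> cover_gen \<Rightarrow> Cq wordspinor endo" where
  "cover_letter s x = (case x of CZ \<Rightarrow> zsign s | CT i \<Rightarrow> twisted_hecke qq s i)"

lemma spin_scalar_action: "scalar_action (\<lambda>c. fibrewise (scalar c)) (twisted_hecke qq True)"
  by (rule scalar_action_twisted_hecke) (rule twisted_hecke_scalar)

lemma cover_scalar_action: "scalar_action (\<lambda>c. fibrewise (scalar c)) (cover_letter s)"
  by (rule scalar_action_twisted_hecke) (simp add: cover_letter_def twisted_hecke_scalar zsign_def split: cover_gen.split)

lemma spin_representation:
  assumes "p \<in> rel_ideal (spin_gens n) (spin_rels n)"
  shows "eval_poly (\<lambda>c. fibrewise (scalar c)) (twisted_hecke qq True) p = 0"
proof -
  interpret scalar_action "\<lambda>c. fibrewise (scalar c)" "twisted_hecke qq True"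
    by (rule spin_scalar_action)
  note q = qq_nonzero
  show ?thesis
  proof (rule eval_rel_ideal[OF spin_rels_closed _ assms])
    fix l r assume "(l, r) \<in> spin_rels n"
    then consider (square) i where "l = gen i * gen i" "r = scal (- (eps^2) - 2)"
      | (commute) i j where "l = gen i * gen j" "r = - (gen j * gen i)" "\<bar>int i - int j\<bar> > 1"
      | (braid) i where "l = gen i * gen (i+1) * gen i - gen (i+1) * gen i * gen (i+1)"
          "r = scal (eps^2) * (gen (i+1) - gen i)"
      unfolding spin_rels_def by blast
    then show "ev l = ev r"
    proof cases
      case square
      have "fibrewise (scalar ((qq - inverse qq)^2 + 3)) * - 1 + 1 = fibrewise (scalar (- (eps^2) - 2))"
      proof -
        have "- (eps^2) - 2 = - ((qq - inverse qq)^2 + 3) + 1" by (simp add: eps_def)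
        then show ?thesis by (simp only: scalar_hom fibrewise_hom) simp
      qed
      then show ?thesis using square twisted_hecke_square[OF q, of True i] by (simp add: eval_simps zsign_def)
    next
      case commute
      then show ?thesis using twisted_hecke_commute[OF commute(3), of qq True]
        by (simp add: eval_simps zsign_def)
    next
      case braid
      then show ?thesis using twisted_hecke_braid[OF q, of True i] by (simp add: eval_simps eps_def)
    qed
  qed
qed

lemma cover_representation:
  assumes "p \<in> rel_ideal (cover_gens n) (cover_rels n)"
  shows "eval_poly (\<lambda>c. fibrewise (scalar c)) (cover_letter s) p = 0"
proof -
  interpret scalar_action "\<lambda>c. fibrewise (scalar c)" "cover_letter s" by (rule cover_scalar_action)
  note q = qq_nonzero
  have letters [simp]: "cover_letter s CZ = zsign s" "cover_letter s (CT i) = twisted_hecke qq s i" for i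
    by (simp_all add: cover_letter_def)
  show ?thesis
  proof (rule eval_rel_ideal[OF cover_rels_closed _ assms])
    fix l r assume "(l, r) \<in> cover_rels n"
    then consider (z) "l = gen CZ * gen CZ" "r = 1"
      | (central) i where "l = gen CZ * gen (CT i)" "r = gen (CT i) * gen CZ"
      | (square) i where "l = gen (CT i) * gen (CT i)" "r = scal (qq^2 + inverse qq^2 + 1) * gen CZ + 1"
      | (commute) i j where "l = gen (CT i) * gen (CT j)" "r = gen CZ * gen (CT j) * gen (CT i)" "\<bar>int i - int j\<bar> > 1"
      | (braid) i where "l = gen (CT i) * gen (CT (i+1)) * gen (CT i) - gen (CT (i+1)) * gen (CT i) * gen (CT (i+1))"
          "r = scal (eps^2) * (gen (CT (i+1)) - gen (CT i))"
      unfolding cover_rels_def by blast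
    then show "ev l = ev r"
    proof cases
      case z
      then show ?thesis by (simp add: eval_simps zsign_def)
    next
      case central
      then show ?thesis by (simp add: eval_simps zsign_def)
    next
      case square
      then show ?thesis
        unfolding eps_square[symmetric] using twisted_hecke_square[OF q, of s i]
          by (simp add: eval_simps eps_def)
    next
      case commute
      then show ?thesis using twisted_hecke_commute[OF commute(3), of qq s] by (simp add: eval_simps)
    next
      case braid
      then show ?thesis using twisted_hecke_braid[OF q, of s i] by (simp add: eval_simps eps_def)
    qed
  qed
qed

lemma sum_even_exps_bool:
  "(\<Sum>i\<in>I \<times> (UNIV :: bool set). h i) = (\<Sum>a\<in>I. h (a, False) + h (a, True))"
  by (simp add: sum.cartesian_product' UNIV_bool)

lemma spin_basis:
  assumes "2 \<le> n"
  shows "basis_family class_ring (spin_hecke_even n) (std_mon (spin_hecke n) (spin_R n) n) (even_exps n)"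
    and "vectorspace.dim class_ring (spin_hecke_even n) = card (even_exps n)"
proof -
  let ?X = "spin_gens n" and ?S = "spin_rels n"
  interpret R: covering_relations ?X "rel_ideal ?X ?S" "- 1" gen "eps ^ 2 + 3" "eps ^ 2" n
    by (rule spin_covering_relations)
  interpret ev: scalar_action "\<lambda>c. fibrewise (scalar c)" "twisted_hecke qq True"
    by (rule spin_scalar_action)
  have n: "1 \<le> n" using assms by simp
  let ?F = "\<lambda>a. std_monomial gen n a :: (Cq, nat) ncpoly"
  have gens: "gen i \<in> free_parity ?X (\<lambda>_. True) False" if "1 \<le> i" "i < n" for i
    using that by (intro free_parity_gen) (auto simp: spin_gens_def)
  have even: "?F a \<in> free_even ?X (\<lambda>_. True)" if "a \<in> even_exps n" for a
  proof -
    have "even (\<Sum>i=1..<n. a i)"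
    proof -
      have "{1..n-1} = {1..<n}" using n by auto
      then show ?thesis using that by (simp add: even_exps_def)
    qed
    then show ?thesis
      using free_parity_std_monomial[of n gen, OF gens even_exps_le[OF that] n] by (simp add: free_parity_even)
  qed
  have indep: "\<forall>a\<in>even_exps n. c a = 0"
    if "(\<Sum>a\<in>even_exps n. scal (c a) * ?F a) \<in> rel_ideal ?X ?S" for c
  proof (rule twisted_hecke_independent[OF two_nonzero n])
    show "(\<Sum>a\<in>even_exps n. fibrewise (scalar (c a)) * std_monomial (twisted_hecke qq True) n a) = 0"
      using spin_representation[OF that] by (simp add: ev.eval_sum ev.eval_simps ev.eval_std_monomial)
  qed
  have span: "\<exists>c. p - (\<Sum>a\<in>even_exps n. scal (c a) * ?F a) \<in> rel_ideal ?X ?S"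
    if p: "p \<in> free_even ?X (\<lambda>_. True)" for p
  proof -
    have "p \<in> R.std_span n True"
      using p
    proof (rule free_even_induct)
      show "0 \<in> R.std_span n True" by (rule R.std_span_J[OF R.J_zero])
      show "p * gen x \<in> R.std_span n (\<pi> = (\<not> True))" if "p \<in> R.std_span n \<pi>" "x \<in> ?X" for p x \<pi>
        using R.std_span_X[OF that(1), of x] that(2) by (auto simp: spin_gens_def)
    qed (use n in \<open>simp_all add: R.std_span_add R.std_span_scal\<close>)
    from R.std_span_spanned[OF this n] obtain c where
      "p - (\<Sum>i\<in>even_exps n \<times> UNIV. scal (c i) * (case i of (a, b) \<Rightarrow> if b then - 1 * ?F a else ?F a))
        \<in> rel_ideal ?X ?S" by blast
    moreover have "(\<Sum>i\<in>even_exps n \<times> UNIV. scal (c i) * (case i of (a, b) \<Rightarrow> if b then - 1 * ?F a else ?F a)) =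
        (\<Sum>a\<in>even_exps n. scal (c (a, False) - c (a, True)) * ?F a)"
      unfolding sum_even_exps_bool
      by (intro sum.cong refl) (simp add: scal_add[of _ "- _", simplified] scal_uminus left_diff_distrib)
    ultimately show ?thesis by (intro exI[of _ "\<lambda>a. c (a, False) - c (a, True)"]) simp
  qed
  have "basis_family class_ring (even_subalg ?X ?S (\<lambda>_. True)) (\<lambda>a. cls ?X ?S (?F a)) (even_exps n)"
    by (rule even_subalg_basis(1)[OF spin_rels_closed finite_even_exps even indep span])
  moreover have "cls ?X ?S (?F a) = std_mon (spin_hecke n) (spin_R n) n a" if "a \<in> even_exps n" for a
    unfolding spin_hecke_def spin_R_def
    using even_exps_le[OF that] by (intro std_mon_presented_alg[symmetric] spin_rels_closed R.X_closed)
  ultimately show "basis_family class_ring (spin_hecke_even n) (std_mon (spin_hecke n) (spin_R n) n) (even_exps n)"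
    unfolding spin_hecke_even_def using basis_family_cong by (metis (no_types, lifting))
  show "vectorspace.dim class_ring (spin_hecke_even n) = card (even_exps n)"
    unfolding spin_hecke_even_def
    by (rule even_subalg_basis(2)[OF spin_rels_closed finite_even_exps even indep span])
qed

text \<open>The representations with \<open>z = 1\<close> and \<open>z = -1\<close> see the sum and the difference of the coefficients of a monomial
and of its multiple by \<open>z\<close>.\<close>
lemma cover_basis:
  assumes "2 \<le> n"
  defines "f \<equiv> \<lambda>(a, b). if b then cover_z n \<otimes>\<^bsub>cover_hecke n\<^esub> std_mon (cover_hecke n) (cover_T n) n a
     else std_mon (cover_hecke n) (cover_T n) n a"
  shows "basis_family class_ring (cover_hecke_even n) f (even_exps n \<times> UNIV)"
    and "vectorspace.dim class_ring (cover_hecke_even n) = 2 * card (even_exps n)"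
proof -
  let ?X = "cover_gens n" and ?S = "cover_rels n" and ?d = "\<lambda>x. x \<noteq> CZ"
  let ?z = "gen CZ :: (Cq, cover_gen) ncpoly" and ?g = "\<lambda>i. gen (CT i) :: (Cq, cover_gen) ncpoly"
  interpret R: covering_relations ?X "rel_ideal ?X ?S" ?z ?g "eps ^ 2 + 3" "eps ^ 2" n
    by (rule cover_covering_relations)
  have n: "1 \<le> n" using assms by simp
  define F where "F = (\<lambda>(a, b). if b then ?z * std_monomial ?g n a else std_monomial ?g n a)"
  have gens: "?g i \<in> free_parity ?X ?d False" if "1 \<le> i" "i < n" for i
    using that by (intro free_parity_gen) (auto simp: cover_gens_def)
  have z_even: "?z \<in> free_parity ?X ?d True"
    by (simp add: free_parity_def gen_closed cover_gens_def) (simp add: gen_def)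
  have std_monomial_even: "std_monomial ?g n a \<in> free_parity ?X ?d True" if "a \<in> even_exps n" for a
  proof -
    have "{1..n-1} = {1..<n}" using n by auto
    then have "even (\<Sum>i=1..<n. a i)" using that by (simp add: even_exps_def)
    then show ?thesis
      using free_parity_std_monomial[of n ?g, OF gens even_exps_le[OF that] n] by simp
  qed
  have even: "F i \<in> free_even ?X ?d" if "i \<in> even_exps n \<times> UNIV" for i
  proof -
    obtain a b where i: "i = (a, b)" by (cases i)
    have "std_monomial ?g n a \<in> free_parity ?X ?d True" using that i by (intro std_monomial_even) simp
    then show ?thesis
      using free_parity_mult[OF z_even, of "std_monomial ?g n a" True] by (simp add: F_def i free_parity_even)
  qed
  have fin: "finite (even_exps n \<times> (UNIV :: bool set))"
    by (simp add: finite_even_exps)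
  have indep: "\<forall>i\<in>even_exps n \<times> UNIV. c i = 0"
    if c: "(\<Sum>i\<in>even_exps n \<times> UNIV. scal (c i) * F i) \<in> rel_ideal ?X ?S" for c
  proof -
    have comp: "\<forall>a\<in>even_exps n. c (a, False) + zsign s * c (a, True) = 0" for s
    proof (rule twisted_hecke_independent[OF two_nonzero n])
      interpret ev: scalar_action "\<lambda>c. fibrewise (scalar c)" "cover_letter s"
        by (rule cover_scalar_action)
      have "(\<Sum>a\<in>even_exps n. scal (c (a, False)) * std_monomial ?g n a + scal (c (a, True)) * (?z * std_monomial ?g n a))
          \<in> rel_ideal ?X ?S"
        using c by (simp add: sum_even_exps_bool F_def)
      from cover_representation[OF this, of s]
      have "0 = (\<Sum>a\<in>even_exps n. fibrewise (scalar (c (a, False))) * std_monomial (twisted_hecke qq s) n a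
          + fibrewise (scalar (c (a, True))) * (zsign s * std_monomial (twisted_hecke qq s) n a))"
        by (simp add: ev.eval_sum ev.eval_simps ev.eval_std_monomial) (simp add: cover_letter_def)
      also have "\<dots> = (\<Sum>a\<in>even_exps n.
          fibrewise (scalar (c (a, False) + zsign s * c (a, True))) * std_monomial (twisted_hecke qq s) n a)"
        by (intro sum.cong refl)
          (simp add: zsign_def scalar_hom fibrewise_hom distrib_right left_diff_distrib)
      finally show "(\<Sum>a\<in>even_exps n.
          fibrewise (scalar (c (a, False) + zsign s * c (a, True))) * std_monomial (twisted_hecke qq s) n a) = 0" by simp
    qed
    have "c (a, b) = 0" if a: "a \<in> even_exps n" for a b
    proof -
      have plus: "c (a, False) + c (a, True) = 0" and minus: "c (a, False) = c (a, True)"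
        using comp[of False] comp[of True] a by (auto simp: zsign_def)
      have "2 * c (a, True) = 0" using plus unfolding minus by simp
      then have "c (a, True) = 0" using two_nonzero by simp
      then show ?thesis using minus by (cases b) simp_all
    qed
    then show ?thesis by auto
  qed
  have span: "\<exists>c. p - (\<Sum>i\<in>even_exps n \<times> UNIV. scal (c i) * F i) \<in> rel_ideal ?X ?S"
    if p: "p \<in> free_even ?X ?d" for p
  proof -
    have "p \<in> R.std_span n True"
      using p
    proof (rule free_even_induct)
      show "0 \<in> R.std_span n True" by (rule R.std_span_J[OF R.J_zero])
      show "p * gen x \<in> R.std_span n (\<pi> = (\<not> x \<noteq> CZ))" if "p \<in> R.std_span n \<pi>" "x \<in> ?X" for p x \<pi>
      proof (cases x)
        case CZ
        then show ?thesis using R.std_span_z[OF that(1) n] by simp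
      next
        case (CT i)
        then have "1 \<le> i" "i < n" using that(2) by (auto simp: cover_gens_def)
        then show ?thesis using R.std_span_X[OF that(1), of i] CT by simp
      qed
    qed (use n in \<open>simp_all add: R.std_span_add R.std_span_scal\<close>)
    from R.std_span_spanned[OF this n] show ?thesis by (simp add: F_def)
  qed
  have "basis_family class_ring (even_subalg ?X ?S ?d) (\<lambda>i. cls ?X ?S (F i)) (even_exps n \<times> UNIV)"
    by (rule even_subalg_basis(1)[OF cover_rels_closed fin even indep span])
  moreover have "cls ?X ?S (F i) = f i" if i: "i \<in> even_exps n \<times> UNIV" for i
  proof -
    obtain a b where ab: "i = (a, b)" "a \<in> even_exps n" using i by auto
    have std_monomial: "std_mon (cover_hecke n) (cover_T n) n a = cls ?X ?S (std_monomial ?g n a)"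
      unfolding cover_hecke_def cover_T_def
      using even_exps_le[OF ab(2)] by (intro std_mon_presented_alg cover_rels_closed R.X_closed)
    have "std_monomial ?g n a \<in> carrier (free_alg ?X)"
      using std_monomial_even[OF ab(2)] by (simp add: free_parity_def)
    then have "cover_z n \<otimes>\<^bsub>cover_hecke n\<^esub> cls ?X ?S (std_monomial ?g n a) = cls ?X ?S (?z * std_monomial ?g n a)"
      unfolding cover_hecke_def cover_z_def
      by (intro presented_alg_ops(3) cover_rels_closed R.z_closed)
    then show ?thesis by (simp add: f_def F_def ab std_monomial)
  qed
  ultimately show "basis_family class_ring (cover_hecke_even n) f (even_exps n \<times> UNIV)"
    unfolding cover_hecke_even_def using basis_family_cong by (metis (no_types, lifting))
  have "vectorspace.dim class_ring (even_subalg ?X ?S ?d) = card (even_exps n \<times> (UNIV :: bool set))"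
    by (rule even_subalg_basis(2)[OF cover_rels_closed fin even indep span])
  then show "vectorspace.dim class_ring (cover_hecke_even n) = 2 * card (even_exps n)"
    by (simp add: cover_hecke_even_def card_cartesian_product)
qed

theorem proposition3p12:
  fixes n :: nat
  assumes "n \<ge> 2"
  shows "(basis_family class_ring (spin_hecke_even n)
            (std_mon (spin_hecke n) (spin_R n) n) (even_exps n)
          \<and> real (vectorspace.dim class_ring (spin_hecke_even n)) = 1 / 2 * fact n)
       \<and> (basis_family class_ring (cover_hecke_even n)
            (\<lambda>(a, b). (if b then cover_z n \<otimes>\<^bsub>cover_hecke n\<^esub> std_mon (cover_hecke n) (cover_T n) n a
                       else std_mon (cover_hecke n) (cover_T n) n a))
            (even_exps n \<times> (UNIV :: bool set))
          \<and> vectorspace.dim class_ring (cover_hecke_even n) = fact n)"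
proof (intro conjI)
  show "real (vectorspace.dim class_ring (spin_hecke_even n)) = 1 / 2 * fact n"
  proof -
    have "2 * real (card (even_exps n)) = fact n"
      using arg_cong[OF card_even_exps[OF assms], of real] by simp
    then show ?thesis using spin_basis(2)[OF assms] by simp
  qed
  show "vectorspace.dim class_ring (cover_hecke_even n) = fact n"
    using cover_basis(2)[OF assms] card_even_exps[OF assms] by simp
qed (rule spin_basis(1)[OF assms] cover_basis(1)[OF assms])+

end
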